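(* Let $R=k[x_1,\ldots,x_n]$ be a polynomial ring over a field $k$ with its standard grading and let $M$ be a finitely generated graded $R$-module. Let $\operatorname{reg}(M)=\max\{b_i(M)-i \mid i\ge 0\}$ be the Castelnuovo-Mumford regularity of $M$ defined via its minimal graded free resolution. Then $$\operatorname{reg}(M)=\max\{t\in\mathbb Z \mid \operatorname{Tor}_i^R(M,k)_{t+i}\neq 0 \text{ for some } i\ge 0\}=\max\{t\in\mathbb Z\mid \operatorname{Ext}^i_R(M,R)_{-t-i}\neq 0\text{ for some } i\ge 0\}.$$
   Context: Let $0\to F_s\to\cdots\to F_1\to F_0\to M\to 0$ be a minimal graded free resolution of $M$ (all maps of degree zero). $b_i(M)$ denotes the maximal degree of the generators of $F_i$, with $b_i(M)=-\infty$ if $F_i=0$. The field $k$ is viewed as the graded module $R/(x_1,\ldots,x_n)$, and $N_t$ denotes the degree-$t$ component of a graded module $N$. The maximum of the empty set is $-\infty$. *)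

theory Defs
  imports
    "HOL-Library.Poly_Mapping"
    "HOL-Library.Function_Algebras"
    "HOL-Library.Extended_Real"
    "HOL-Computational_Algebra.Group_Closure"
    "HOL-Algebra.Coset"
begin

text \<open>The polynomial ring over \<open>'k\<close> in the variables \<open>x :: 'x\<close>, where \<open>'x\<close> is a finite type, so
  \<open>n = CARD('x)\<close>. The ring structure is the convolution product of \<^typ>\<open>('x \<Rightarrow>\<^sub>0 nat) \<Rightarrow>\<^sub>0 'k\<close>.\<close>

type_synonym ('x, 'k) mpoly = "('x \<Rightarrow>\<^sub>0 nat) \<Rightarrow>\<^sub>0 'k"

definition Var :: "'x \<Rightarrow> ('x, 'k::comm_ring_1) mpoly" where
  "Var x = Poly_Mapping.single (Poly_Mapping.single x 1) 1"

definition monom_deg :: "('x::finite \<Rightarrow>\<^sub>0 nat) \<Rightarrow> nat" where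
  "monom_deg m = (\<Sum>x\<in>UNIV. Poly_Mapping.lookup m x)"

definition mpoly_comp :: "int \<Rightarrow> ('x::finite, 'k::comm_ring_1) mpoly set" where
  "mpoly_comp d = {p. \<forall>m\<in>Poly_Mapping.keys p. int (monom_deg m) = d}"

definition irrelevant_ideal :: "('x::finite, 'k::comm_ring_1) mpoly set" where
  "irrelevant_ideal = Modules.module.span (*) (range Var)"


section \<open>Graded modules\<close>

text \<open>A module is a submodule \<open>carr\<close> of a module structure \<open>smult\<close> on a whole type; \<open>comp d\<close> is its
  component of degree \<open>d\<close>.\<close>

record ('r, 'm) grmod =
  smult :: "'r \<Rightarrow> 'm \<Rightarrow> 'm"
  carr :: "'m set"
  comp :: "int \<Rightarrow> 'm set"

definition graded_module ::
    "(('x::finite, 'k::field) mpoly, 'm::ab_group_add) grmod \<Rightarrow> bool" where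
  "graded_module M \<longleftrightarrow>
     Modules.module (smult M) \<and>
     Modules.module.subspace (smult M) (carr M) \<and>
     (\<forall>d. comp M d \<subseteq> carr M \<and> 0 \<in> comp M d \<and>
          (\<forall>u\<in>comp M d. \<forall>v\<in>comp M d. u - v \<in> comp M d)) \<and>
     (\<forall>a b. \<forall>p\<in>mpoly_comp a. \<forall>v\<in>comp M b. smult M p v \<in> comp M (a + b)) \<and>
     (\<forall>v\<in>carr M. \<exists>!f. (\<forall>d. f d \<in> comp M d) \<and> finite {d. f d \<noteq> 0} \<and>
          v = (\<Sum>d | f d \<noteq> 0. f d))"

definition finitely_generated :: "('r::comm_ring_1, 'm::ab_group_add) grmod \<Rightarrow> bool" where
  "finitely_generated M \<longleftrightarrow>
     (\<exists>S. finite S \<and> S \<subseteq> carr M \<and> Modules.module.span (smult M) S = carr M)"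

definition ring_grmod :: "(('x::finite, 'k::field) mpoly, ('x, 'k) mpoly) grmod" where
  "ring_grmod = \<lparr>smult = (*), carr = UNIV, comp = mpoly_comp\<rparr>"

text \<open>The module \<open>R/(x\<^sub>1,\<dots>,x\<^sub>n)\<close>, realised on \<open>k\<close> itself: a polynomial acts through its constant
  coefficient, and everything sits in degree 0. That this is the quotient by the ideal generated
  by the variables is lemma \<open>lookup_0_eq_0_iff\<close> below.\<close>

definition residue_grmod :: "(('x::finite, 'k::field) mpoly, 'k) grmod" where
  "residue_grmod = \<lparr>smult = (\<lambda>p c. Poly_Mapping.lookup p 0 * c), carr = UNIV,
     comp = (\<lambda>d. if d = 0 then UNIV else {0})\<rparr>"

text \<open>\<open>free_grmod ds\<close> is the direct sum of the twists \<open>R(-d)\<close> for \<open>d\<close> in \<open>ds\<close>: its \<open>j\<close>-th basis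
  vector has degree \<open>ds ! j\<close>.\<close>

definition free_grmod :: "int list \<Rightarrow> (('x::finite, 'k::field) mpoly, nat \<Rightarrow> ('x, 'k) mpoly) grmod" where
  "free_grmod ds =
     \<lparr>smult = (\<lambda>p v j. p * v j),
      carr = {v. \<forall>j\<ge>length ds. v j = 0},
      comp = (\<lambda>d. {v. (\<forall>j\<ge>length ds. v j = 0) \<and>
                      (\<forall>j<length ds. v j \<in> mpoly_comp (d - ds ! j))})\<rparr>"

text \<open>Homomorphisms that raise degrees by \<open>d\<close>. Values outside the carrier are fixed to be 0, so
  that equality and addition of functions are those of homomorphisms.\<close>

definition grhom ::
    "('r, 'a::ab_group_add) grmod \<Rightarrow> ('r, 'b::ab_group_add) grmod \<Rightarrow> int \<Rightarrow> ('a \<Rightarrow> 'b) set" where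
  "grhom A B d = {f.
     (\<forall>v. v \<notin> carr A \<longrightarrow> f v = 0) \<and>
     (\<forall>v\<in>carr A. f v \<in> carr B) \<and>
     (\<forall>u\<in>carr A. \<forall>v\<in>carr A. f (u + v) = f u + f v) \<and>
     (\<forall>p. \<forall>v\<in>carr A. f (smult A p v) = smult B p (f v)) \<and>
     (\<forall>e. \<forall>v\<in>comp A e. f v \<in> comp B (e + d))}"


section \<open>Graded free resolutions\<close>

text \<open>\<open>F\<^sub>i = free_grmod (gens P i)\<close>, and \<open>diff P i\<close> is the map \<open>F\<^sub>i\<^sub>+\<^sub>1 \<rightarrow> F\<^sub>i\<close>.\<close>

record ('r, 'm) gfree_complex =
  gens :: "nat \<Rightarrow> int list"
  diff :: "nat \<Rightarrow> (nat \<Rightarrow> 'r) \<Rightarrow> (nat \<Rightarrow> 'r)"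
  aug :: "(nat \<Rightarrow> 'r) \<Rightarrow> 'm"

abbreviation term_of :: "(('x::finite, 'k::field) mpoly, 'm) gfree_complex \<Rightarrow> nat \<Rightarrow>
    (('x, 'k) mpoly, nat \<Rightarrow> ('x, 'k) mpoly) grmod" where
  "term_of P i \<equiv> free_grmod (gens P i)"

definition graded_free_resolution ::
    "(('x::finite, 'k::field) mpoly, 'm::ab_group_add) grmod \<Rightarrow> (('x, 'k) mpoly, 'm) gfree_complex \<Rightarrow> bool" where
  "graded_free_resolution M P \<longleftrightarrow>
     aug P \<in> grhom (term_of P 0) M 0 \<and>
     (\<forall>i. diff P i \<in> grhom (term_of P (Suc i)) (term_of P i) 0) \<and>
     aug P ` carr (term_of P 0) = carr M \<and>
     {v \<in> carr (term_of P 0). aug P v = 0} = diff P 0 ` carr (term_of P 1) \<and>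
     (\<forall>i. {v \<in> carr (term_of P (Suc i)). diff P i v = 0} =
          diff P (Suc i) ` carr (term_of P (Suc (Suc i))))"

definition minimal_graded_free_resolution ::
    "(('x::finite, 'k::field) mpoly, 'm::ab_group_add) grmod \<Rightarrow> (('x, 'k) mpoly, 'm) gfree_complex \<Rightarrow> bool" where
  "minimal_graded_free_resolution M P \<longleftrightarrow>
     graded_free_resolution M P \<and>
     (\<exists>s. \<forall>i>s. gens P i = []) \<and>
     (\<forall>i. diff P i ` carr (term_of P (Suc i)) \<subseteq>
          Modules.module.span (smult (term_of P i))
            {smult (term_of P i) p v | p v. p \<in> irrelevant_ideal \<and> v \<in> carr (term_of P i)})"

definition max_gen_degree :: "('r, 'm) gfree_complex \<Rightarrow> nat \<Rightarrow> ereal" where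
  "max_gen_degree P i =
     (if gens P i = [] then -\<infinity> else ereal (of_int (Max (set (gens P i)))))"

text \<open>The maximum is over a finite set: only finitely many \<open>F\<^sub>i\<close> are nonzero in a minimal
  resolution.\<close>

definition reg :: "('r, 'm) gfree_complex \<Rightarrow> ereal" where
  "reg P = Max {max_gen_degree P i - ereal (real i) | i. True}"


section \<open>Tensor products\<close>

text \<open>\<open>A \<otimes> N\<close> is the free abelian group on \<open>carr A \<times> carr N\<close> modulo the subgroup \<open>tensor_rel A N\<close>.
  Its component of degree \<open>d\<close> consists of the classes of the elements of \<open>tensor_comp A N d\<close>.\<close>

definition tensor_rel :: "('r, 'a::ab_group_add) grmod \<Rightarrow> ('r, 'n::ab_group_add) grmod \<Rightarrow>
    ('a \<times> 'n \<Rightarrow>\<^sub>0 int) set" where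
  "tensor_rel A N = group_closure (
     {frag_of (a + a', n) - frag_of (a, n) - frag_of (a', n) | a a' n.
        a \<in> carr A \<and> a' \<in> carr A \<and> n \<in> carr N} \<union>
     {frag_of (a, n + n') - frag_of (a, n) - frag_of (a, n') | a n n'.
        a \<in> carr A \<and> n \<in> carr N \<and> n' \<in> carr N} \<union>
     {frag_of (smult A p a, n) - frag_of (a, smult N p n) | p a n.
        a \<in> carr A \<and> n \<in> carr N})"

definition tensor_comp :: "('r, 'a::ab_group_add) grmod \<Rightarrow> ('r, 'n::ab_group_add) grmod \<Rightarrow> int \<Rightarrow>
    ('a \<times> 'n \<Rightarrow>\<^sub>0 int) set" where
  "tensor_comp A N d =
     group_closure {frag_of (a, n) | a n. \<exists>i j. i + j = d \<and> a \<in> comp A i \<and> n \<in> comp N j}"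

definition tensor_map :: "('a \<Rightarrow> 'b) \<Rightarrow> ('a \<times> 'n \<Rightarrow>\<^sub>0 int) \<Rightarrow> ('b \<times> 'n \<Rightarrow>\<^sub>0 int)" where
  "tensor_map f = frag_extend (\<lambda>(a, n). frag_of (f a, n))"


section \<open>Tor and Ext\<close>

definition additive_group :: "'a::ab_group_add set \<Rightarrow> 'a monoid" where
  "additive_group Z = \<lparr>carrier = Z, monoid.mult = (+), one = 0\<rparr>"

definition nonzero_group :: "'a monoid \<Rightarrow> bool" where
  "nonzero_group G \<longleftrightarrow> carrier G \<noteq> {\<one>\<^bsub>G\<^esub>}"

definition resolution_of ::
    "(('x::finite, 'k::field) mpoly, 'm::ab_group_add) grmod \<Rightarrow> (('x, 'k) mpoly, 'm) gfree_complex" where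
  "resolution_of M = (SOME P. graded_free_resolution M P)"

text \<open>Cycles and boundaries of degree \<open>d\<close> in \<open>F\<^sub>i \<otimes> N\<close>, given by representatives modulo
  \<open>tensor_rel\<close>.\<close>

definition tor_cycles :: "(('x::finite, 'k::field) mpoly, 'm) gfree_complex \<Rightarrow>
    (('x, 'k) mpoly, 'n::ab_group_add) grmod \<Rightarrow> nat \<Rightarrow> int \<Rightarrow>
    ((nat \<Rightarrow> ('x, 'k) mpoly) \<times> 'n \<Rightarrow>\<^sub>0 int) set" where
  "tor_cycles P N i d = {z \<in> tensor_comp (term_of P i) N d.
     (case i of 0 \<Rightarrow> True
      | Suc j \<Rightarrow> tensor_map (diff P j) z \<in> tensor_rel (term_of P j) N)}"

definition tor_boundaries :: "(('x::finite, 'k::field) mpoly, 'm) gfree_complex \<Rightarrow>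
    (('x, 'k) mpoly, 'n::ab_group_add) grmod \<Rightarrow> nat \<Rightarrow> int \<Rightarrow>
    ((nat \<Rightarrow> ('x, 'k) mpoly) \<times> 'n \<Rightarrow>\<^sub>0 int) set" where
  "tor_boundaries P N i d = {z \<in> tensor_comp (term_of P i) N d.
     \<exists>w\<in>tensor_comp (term_of P (Suc i)) N d.
       z - tensor_map (diff P i) w \<in> tensor_rel (term_of P i) N}"

text \<open>\<open>Tor\<^sub>i(M, N)\<^sub>d\<close>\<close>

definition Tor :: "(('x::finite, 'k::field) mpoly, 'm::ab_group_add) grmod \<Rightarrow>
    (('x, 'k) mpoly, 'n::ab_group_add) grmod \<Rightarrow> nat \<Rightarrow> int \<Rightarrow>
    ((nat \<Rightarrow> ('x, 'k) mpoly) \<times> 'n \<Rightarrow>\<^sub>0 int) set monoid" where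
  "Tor M N i d = additive_group (tor_cycles (resolution_of M) N i d)
     Mod tor_boundaries (resolution_of M) N i d"

definition ext_cocycles :: "(('x::finite, 'k::field) mpoly, 'm) gfree_complex \<Rightarrow>
    (('x, 'k) mpoly, 'n::ab_group_add) grmod \<Rightarrow> nat \<Rightarrow> int \<Rightarrow>
    ((nat \<Rightarrow> ('x, 'k) mpoly) \<Rightarrow> 'n) set" where
  "ext_cocycles P N i d = {f \<in> grhom (term_of P i) N d. f \<circ> diff P i = 0}"

definition ext_coboundaries :: "(('x::finite, 'k::field) mpoly, 'm) gfree_complex \<Rightarrow>
    (('x, 'k) mpoly, 'n::ab_group_add) grmod \<Rightarrow> nat \<Rightarrow> int \<Rightarrow>
    ((nat \<Rightarrow> ('x, 'k) mpoly) \<Rightarrow> 'n) set" where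
  "ext_coboundaries P N i d =
     (case i of 0 \<Rightarrow> {0} | Suc j \<Rightarrow> (\<lambda>g. g \<circ> diff P j) ` grhom (term_of P j) N d)"

text \<open>\<open>Ext\<^sup>i(M, N)\<^sub>d\<close>; the grading is by the degree of homomorphisms, which for finitely generated
  \<open>F\<^sub>i\<close> exhausts \<open>Hom(F\<^sub>i, N)\<close>.\<close>

definition Ext :: "(('x::finite, 'k::field) mpoly, 'm::ab_group_add) grmod \<Rightarrow>
    (('x, 'k) mpoly, 'n::ab_group_add) grmod \<Rightarrow> nat \<Rightarrow> int \<Rightarrow>
    ((nat \<Rightarrow> ('x, 'k) mpoly) \<Rightarrow> 'n) set monoid" where
  "Ext M N i d = additive_group (ext_cocycles (resolution_of M) N i d)
     Mod ext_coboundaries (resolution_of M) N i d"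


section \<open>Maxima of sets of integers\<close>

text \<open>Stated for possibly infinite sets, where \<open>Max\<close> is unspecified: the degrees in which some \<open>Ext\<close>
  module is nonzero are in general unbounded in one direction.\<close>

definition is_max :: "int set \<Rightarrow> ereal \<Rightarrow> bool" where
  "is_max T r \<longleftrightarrow>
     (if T = {} then r = -\<infinity> else \<exists>m\<in>T. (\<forall>t\<in>T. t \<le> m) \<and> r = ereal (of_int m))"


section \<open>The residue field\<close>

lemma module_mult: "Modules.module ((*) :: 'r::comm_ring_1 \<Rightarrow> 'r \<Rightarrow> 'r)"
  by unfold_locales (simp_all add: algebra_simps)

lemma poly_mapping_sum_single:
  "p = (\<Sum>m\<in>Poly_Mapping.keys p. Poly_Mapping.single m (Poly_Mapping.lookup p m))"
proof (rule poly_mapping_eqI)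
  fix k
  have "(\<Sum>m\<in>Poly_Mapping.keys p.
          Poly_Mapping.lookup (Poly_Mapping.single m (Poly_Mapping.lookup p m)) k) =
        (\<Sum>m\<in>Poly_Mapping.keys p. if m = k then Poly_Mapping.lookup p m else 0)"
    by (rule sum.cong) (auto simp: lookup_single when_def)
  then show "Poly_Mapping.lookup p k = Poly_Mapping.lookup
      (\<Sum>m\<in>Poly_Mapping.keys p. Poly_Mapping.single m (Poly_Mapping.lookup p m)) k"
    by (simp add: lookup_sum not_in_keys_iff_lookup_eq_zero sum.delta)
qed

lemma lookup_0_mult_Var:
  fixes p :: "('x::finite, 'k::comm_ring_1) mpoly"
  shows "Poly_Mapping.lookup (p * Var x) 0 = 0"
proof -
  have ne: "m + Poly_Mapping.single x (1::nat) \<noteq> 0" for m :: "'x \<Rightarrow>\<^sub>0 nat"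
  proof
    assume "m + Poly_Mapping.single x 1 = 0"
    then have "Poly_Mapping.lookup (m + Poly_Mapping.single x 1) x = 0" by simp
    then show False by (simp add: lookup_add)
  qed
  have "p * Var x = (\<Sum>m\<in>Poly_Mapping.keys p.
      Poly_Mapping.single m (Poly_Mapping.lookup p m) * Var x)"
    by (subst poly_mapping_sum_single [of p]) (rule sum_distrib_right)
  also have "\<dots> = (\<Sum>m\<in>Poly_Mapping.keys p.
      Poly_Mapping.single (m + Poly_Mapping.single x 1) (Poly_Mapping.lookup p m))"
    by (simp add: Var_def mult_single)
  finally show ?thesis
    by (simp add: lookup_sum lookup_single_not_eq ne del: One_nat_def)
qed

lemma lookup_0_eq_0_iff:
  fixes p :: "('x::finite, 'k::comm_ring_1) mpoly"
  shows "Poly_Mapping.lookup p 0 = 0 \<longleftrightarrow> p \<in> irrelevant_ideal"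
proof
  interpret R: Modules.module "(*) :: ('x, 'k) mpoly \<Rightarrow> _" by (rule module_mult)
  show "Poly_Mapping.lookup p 0 = 0" if "p \<in> irrelevant_ideal"
    using that unfolding irrelevant_ideal_def
    by (induction rule: R.span_induct_alt) (auto simp: lookup_add lookup_0_mult_Var)
  assume p0: "Poly_Mapping.lookup p 0 = 0"
  have "Poly_Mapping.single m (Poly_Mapping.lookup p m) \<in> R.span (range Var)"
    if m: "m \<in> Poly_Mapping.keys p" for m
  proof -
    have "m \<noteq> 0" using m p0 by (auto simp: in_keys_iff)
    then obtain x where x: "Poly_Mapping.lookup m x \<noteq> 0"
      by (metis lookup_zero poly_mapping_eqI)
    define m' where "m' = m - Poly_Mapping.single x 1"
    have "m = m' + Poly_Mapping.single x 1"
      using x by (intro poly_mapping_eqI)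
        (auto simp: m'_def lookup_add lookup_minus lookup_single when_def)
    then have "Poly_Mapping.single m (Poly_Mapping.lookup p m) =
        Poly_Mapping.single m' (Poly_Mapping.lookup p m) * Var x"
      by (simp add: Var_def mult_single)
    then show ?thesis by (simp add: R.span_scale R.span_base)
  qed
  then show "p \<in> irrelevant_ideal"
    unfolding irrelevant_ideal_def by (subst poly_mapping_sum_single) (rule R.span_sum)
qed

end

theory Submission
  imports Defs "HOL-Algebra.Elementary_Groups"
begin

text \<open>Any two graded free resolutions of \<open>M\<close> are homotopy equivalent by maps of degree 0, so \<open>Tor\<close>
  and \<open>Ext\<close> can be computed from the minimal resolution \<open>F\<close>. Minimality says that the differentials
  have entries without constant term, so those of \<open>F \<otimes> k\<close> vanish and \<open>Tor\<^sub>i(M, k)\<^sub>d \<noteq> 0\<close> exactly when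
  \<open>d\<close> is the degree of a generator of \<open>F\<^sub>i\<close>. A map \<open>F\<^sub>i \<rightarrow> R\<close> of degree \<open>-t - i\<close> vanishes unless
  \<open>t \<le> b\<^sub>i - i\<close>, which bounds the degrees of \<open>Ext\<close> by the regularity. For the last \<open>i\<close> with
  \<open>b\<^sub>i - i = reg M\<close>, all generators of \<open>F\<^sub>i\<^sub>+\<^sub>1\<close> have degree at most \<open>b\<^sub>i\<close>, and the dual of a generator
  of \<open>F\<^sub>i\<close> of degree \<open>b\<^sub>i\<close> is a cocycle. It is not a coboundary, because coboundaries take values
  without constant term.\<close>

section \<open>Homogeneous polynomials\<close>

abbreviation const_term :: "('x, 'k::zero) mpoly \<Rightarrow> 'k" where
  "const_term p \<equiv> Poly_Mapping.lookup p 0"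

lift_definition hom_part :: "int \<Rightarrow> ('x::finite, 'k::zero) mpoly \<Rightarrow> ('x, 'k) mpoly" is
  "\<lambda>d p m. p m when int (monom_deg m) = d"
  by (erule finite_subset[rotated]) auto

lemma mpoly_comp_iff:
  "p \<in> mpoly_comp d \<longleftrightarrow> (\<forall>m. Poly_Mapping.lookup p m \<noteq> 0 \<longrightarrow> int (monom_deg m) = d)"
  by (auto simp: mpoly_comp_def in_keys_iff)

lemma zero_in_mpoly_comp [simp]: "0 \<in> mpoly_comp d"
  by (simp add: mpoly_comp_iff)

lemma one_in_mpoly_comp: "1 \<in> mpoly_comp 0"
  by (auto simp: mpoly_comp_iff lookup_one when_def monom_deg_def)

lemma diff_in_mpoly_comp: "p \<in> mpoly_comp d \<Longrightarrow> q \<in> mpoly_comp d \<Longrightarrow> p - q \<in> mpoly_comp d"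
  unfolding mpoly_comp_iff lookup_minus by (metis diff_zero)

lemma monom_deg_add: "monom_deg (a + b) = monom_deg a + monom_deg b"
  by (simp add: monom_deg_def lookup_add sum.distrib)

lemma mult_in_mpoly_comp:
  "p \<in> mpoly_comp a \<Longrightarrow> q \<in> mpoly_comp b \<Longrightarrow> p * q \<in> mpoly_comp (a + b)"
  using keys_mult[of p q] by (fastforce simp: mpoly_comp_def monom_deg_add)

lemma monom_deg_eq_0_iff: "monom_deg m = 0 \<longleftrightarrow> m = 0"
  by (auto simp: monom_deg_def intro: poly_mapping_eqI)

lemma mpoly_comp_negative: "p \<in> mpoly_comp d \<Longrightarrow> d < 0 \<Longrightarrow> p = 0"
  by (intro poly_mapping_eqI) (force simp: mpoly_comp_iff)

lemma const_term_mpoly_comp: "p \<in> mpoly_comp d \<Longrightarrow> d \<noteq> 0 \<Longrightarrow> const_term p = 0"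
  by (force simp: mpoly_comp_iff monom_deg_eq_0_iff)

lemma mpoly_comp_0_eq_0:
  assumes "p \<in> mpoly_comp 0" "const_term p = 0"
  shows "p = 0"
proof (rule poly_mapping_eqI)
  fix m show "Poly_Mapping.lookup p m = Poly_Mapping.lookup 0 m"
    using assms by (cases "m = 0") (force simp: mpoly_comp_iff monom_deg_eq_0_iff)+
qed

lemma const_term_mult:
  fixes p q :: "('x::finite, 'k::comm_ring_1) mpoly"
  shows "const_term (p * q) = const_term p * const_term q"
proof -
  interpret R: Modules.module "(*) :: ('x, 'k) mpoly \<Rightarrow> _" by (rule module_mult)
  let ?c = "\<lambda>p. Poly_Mapping.single 0 (const_term p) :: ('x, 'k) mpoly"
  have "p - ?c p \<in> irrelevant_ideal" "q - ?c q \<in> irrelevant_ideal"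
    by (simp_all add: lookup_minus flip: lookup_0_eq_0_iff)
  then have "q * (p - ?c p) + ?c p * (q - ?c q) \<in> irrelevant_ideal"
    unfolding irrelevant_ideal_def by (intro R.span_add R.span_scale)
  moreover have "q * (p - ?c p) + ?c p * (q - ?c q) = p * q - ?c p * ?c q"
    by (simp add: algebra_simps)
  ultimately show ?thesis
    by (simp add: lookup_minus mult_single flip: lookup_0_eq_0_iff)
qed

lemma hom_part_in_mpoly_comp [simp]: "hom_part d p \<in> mpoly_comp d"
  by (simp add: mpoly_comp_iff hom_part.rep_eq)

lemma hom_part_mpoly_comp: "p \<in> mpoly_comp e \<Longrightarrow> hom_part d p = (if d = e then p else 0)"
  by (rule poly_mapping_eqI) (auto simp: mpoly_comp_iff hom_part.rep_eq when_def)

lemma hom_part_add: "hom_part d (p + q) = hom_part d p + hom_part d q"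
  by (rule poly_mapping_eqI) (simp add: hom_part.rep_eq lookup_add when_add_distrib)

lemma hom_part_zero [simp]: "hom_part d 0 = 0"
  by (rule poly_mapping_eqI) (simp add: hom_part.rep_eq)

lemma sum_hom_part:
  assumes "finite S" "\<And>m. m \<in> Poly_Mapping.keys p \<Longrightarrow> int (monom_deg m) + c \<in> S"
  shows "(\<Sum>d\<in>S. hom_part (d - c) p) = p"
proof (rule poly_mapping_eqI)
  fix m
  have "Poly_Mapping.lookup (\<Sum>d\<in>S. hom_part (d - c) p) m =
      (\<Sum>d\<in>S. if d = int (monom_deg m) + c then Poly_Mapping.lookup p m else 0)"
    unfolding lookup_sum by (rule sum.cong) (auto simp: hom_part.rep_eq when_def)
  also have "\<dots> = Poly_Mapping.lookup p m"
    using assms by (auto simp: sum.delta' in_keys_iff)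
  finally show "Poly_Mapping.lookup (\<Sum>d\<in>S. hom_part (d - c) p) m = Poly_Mapping.lookup p m" .
qed

section \<open>Graded modules\<close>

definition homogeneous_decomposition ::
    "('r, 'm::ab_group_add) grmod \<Rightarrow> 'm \<Rightarrow> (int \<Rightarrow> 'm) \<Rightarrow> bool" where
  "homogeneous_decomposition M v f \<longleftrightarrow>
     (\<forall>d. f d \<in> comp M d) \<and> finite {d. f d \<noteq> 0} \<and> v = (\<Sum>d | f d \<noteq> 0. f d)"

lemma homogeneous_decompositionI:
  assumes "\<And>d. f d \<in> comp M d" "finite S" "\<And>d. d \<notin> S \<Longrightarrow> f d = 0" "v = (\<Sum>d\<in>S. f d)"
  shows "homogeneous_decomposition M v f"
proof -
  have "{d. f d \<noteq> 0} \<subseteq> S" using assms(3) by blast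
  with assms show ?thesis
    unfolding homogeneous_decomposition_def
    by (auto intro: finite_subset sum.mono_neutral_right)
qed

lemma graded_moduleD:
  assumes "graded_module M"
  shows graded_module_module: "Modules.module (smult M)"
    and graded_module_subspace: "Modules.module.subspace (smult M) (carr M)"
    and comp_subset_carr: "v \<in> comp M d \<Longrightarrow> v \<in> carr M"
    and comp_zero: "0 \<in> comp M d"
    and comp_diff: "u \<in> comp M d \<Longrightarrow> v \<in> comp M d \<Longrightarrow> u - v \<in> comp M d"
    and comp_smult: "p \<in> mpoly_comp a \<Longrightarrow> v \<in> comp M b \<Longrightarrow> smult M p v \<in> comp M (a + b)"
    and homogeneous_decomposition_ex1: "v \<in> carr M \<Longrightarrow> \<exists>!f. homogeneous_decomposition M v f"
  using assms unfolding graded_module_def homogeneous_decomposition_def by blast+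

lemma carr_zero: "graded_module M \<Longrightarrow> 0 \<in> carr M"
  by (rule Modules.module.subspace_0[OF graded_module_module graded_module_subspace])

lemma carr_add: "graded_module M \<Longrightarrow> u \<in> carr M \<Longrightarrow> v \<in> carr M \<Longrightarrow> u + v \<in> carr M"
  by (rule Modules.module.subspace_add[OF graded_module_module graded_module_subspace])

lemma carr_diff: "graded_module M \<Longrightarrow> u \<in> carr M \<Longrightarrow> v \<in> carr M \<Longrightarrow> u - v \<in> carr M"
  by (rule Modules.module.subspace_diff[OF graded_module_module graded_module_subspace])

lemma carr_smult: "graded_module M \<Longrightarrow> v \<in> carr M \<Longrightarrow> smult M p v \<in> carr M"
  by (rule Modules.module.subspace_scale[OF graded_module_module graded_module_subspace])

lemma carr_sum: "graded_module M \<Longrightarrow> (\<And>j. j \<in> J \<Longrightarrow> v j \<in> carr M) \<Longrightarrow> sum v J \<in> carr M"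
  by (rule Modules.module.subspace_sum[OF graded_module_module graded_module_subspace])

lemma comp_add: "graded_module M \<Longrightarrow> u \<in> comp M d \<Longrightarrow> v \<in> comp M d \<Longrightarrow> u + v \<in> comp M d"
  by (metis comp_diff comp_zero diff_0 diff_minus_eq_add)

lemma comp_sum:
  "graded_module M \<Longrightarrow> (\<And>j. j \<in> J \<Longrightarrow> v j \<in> comp M d) \<Longrightarrow> sum v J \<in> comp M d"
  by (induction J rule: infinite_finite_induct) (auto simp: comp_zero comp_add)

lemma homogeneous_decomposition_component:
  assumes M: "graded_module M" and b: "b \<in> comp M d" and f: "homogeneous_decomposition M b f"
  shows "f d = b"
proof -
  have "homogeneous_decomposition M b (\<lambda>e. if e = d then b else 0)"
    by (rule homogeneous_decompositionI[of _ _ "{d}"]) (auto simp: b comp_zero[OF M])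
  then have "f = (\<lambda>e. if e = d then b else 0)"
    using homogeneous_decomposition_ex1[OF M comp_subset_carr[OF M b]] f by blast
  then show ?thesis by simp
qed

lemma graded_moduleI:
  fixes M :: "(('x::finite, 'k::field) mpoly, 'm::ab_group_add) grmod" and proj :: "int \<Rightarrow> 'm \<Rightarrow> 'm"
  assumes module: "Modules.module (smult M)" "Modules.module.subspace (smult M) (carr M)"
    and comp: "\<And>d. comp M d \<subseteq> carr M" "\<And>d u v. u \<in> comp M d \<Longrightarrow> v \<in> comp M d \<Longrightarrow> u - v \<in> comp M d"
      "\<And>a b p v. p \<in> mpoly_comp a \<Longrightarrow> v \<in> comp M b \<Longrightarrow> smult M p v \<in> comp M (a + b)"
    and proj_comp: "\<And>d v. v \<in> carr M \<Longrightarrow> proj d v \<in> comp M d"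
    and proj_add: "\<And>d u v. proj d (u + v) = proj d u + proj d v"
    and proj_on_comp: "\<And>d e v. v \<in> comp M e \<Longrightarrow> proj d v = (if d = e then v else 0)"
    and proj_sum: "\<And>v. v \<in> carr M \<Longrightarrow> \<exists>S. finite S \<and> v = (\<Sum>d\<in>S. proj d v)"
  shows "graded_module M"
proof -
  have proj_comp_sum: "proj d (\<Sum>e\<in>S. f e) = (if d \<in> S then f d else 0)"
    if "finite S" "\<And>e. f e \<in> comp M e" for d S f
  proof -
    interpret additive "proj d" by unfold_locales (rule proj_add)
    have "proj d (\<Sum>e\<in>S. f e) = (\<Sum>e\<in>S. if d = e then f e else 0)"
      by (simp add: sum proj_on_comp[OF that(2)])
    then show ?thesis using that(1) by simp
  qed
  have "\<exists>!f. homogeneous_decomposition M v f" if v: "v \<in> carr M" for v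
  proof (rule ex1I)
    obtain S where S: "finite S" "v = (\<Sum>d\<in>S. proj d v)" using proj_sum[OF v] by blast
    show "homogeneous_decomposition M v (\<lambda>d. proj d v)"
    proof (rule homogeneous_decompositionI[OF proj_comp[OF v] S(1) _ S(2)])
      show "proj d v = 0" if "d \<notin> S" for d
        using proj_comp_sum[OF S(1) proj_comp[OF v]] S(2) that by (metis (no_types))
    qed
    show "f = (\<lambda>d. proj d v)" if "homogeneous_decomposition M v f" for f
      using that proj_comp_sum[of "{d. f d \<noteq> 0}" f]
      by (auto simp: homogeneous_decomposition_def fun_eq_iff)
  qed
  moreover have "0 \<in> comp M d" for d
    using proj_comp[OF Modules.module.subspace_0[OF module]] comp(2) by (metis diff_self)
  ultimately show ?thesis
    using module comp unfolding graded_module_def homogeneous_decomposition_def by simp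
qed

lemma graded_module_ring_grmod [simp]:
  "graded_module (ring_grmod :: (('x::finite, 'k::field) mpoly, ('x, 'k) mpoly) grmod)"
proof -
  interpret R: Modules.module "(*) :: ('x, 'k) mpoly \<Rightarrow> _" by (rule module_mult)
  show ?thesis
  proof (rule graded_moduleI[where proj = hom_part])
    fix p :: "('x, 'k) mpoly"
    show "\<exists>S. finite S \<and> p = (\<Sum>d\<in>S. hom_part d p)"
      using sum_hom_part[of "(\<lambda>m. int (monom_deg m)) ` Poly_Mapping.keys p" p 0]
      by (intro exI[of _ "(\<lambda>m. int (monom_deg m)) ` Poly_Mapping.keys p"]) simp
  qed (simp_all add: ring_grmod_def R.module_axioms diff_in_mpoly_comp mult_in_mpoly_comp
      hom_part_add hom_part_mpoly_comp)
qed

lemma graded_module_residue_grmod [simp]: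
  "graded_module (residue_grmod :: (('x::finite, 'k::field) mpoly, 'k) grmod)"
proof -
  interpret k: Modules.module "smult residue_grmod :: ('x, 'k) mpoly \<Rightarrow> 'k \<Rightarrow> 'k"
    by unfold_locales (simp_all add: residue_grmod_def lookup_add const_term_mult algebra_simps)
  show ?thesis
  proof (rule graded_moduleI[where proj = "\<lambda>d c. if d = 0 then c else 0"])
    fix c :: 'k
    show "\<exists>S. finite S \<and> c = (\<Sum>d\<in>S. if d = (0::int) then c else 0)"
      by (rule exI[of _ "{0}"]) simp
  next
    fix a b :: int and p :: "('x, 'k) mpoly" and c :: 'k
    assume "p \<in> mpoly_comp a" "c \<in> comp residue_grmod b"
    then show "smult residue_grmod p c \<in> comp residue_grmod (a + b)"
      using const_term_mpoly_comp[of p a] by (auto simp: residue_grmod_def split: if_splits)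
  next
    show "k.subspace (carr residue_grmod)" unfolding k.subspace_def by (simp add: residue_grmod_def)
  qed (rule k.module_axioms, auto simp: residue_grmod_def split: if_splits)
qed

section \<open>Homomorphisms of graded modules\<close>

lemma grhomD:
  assumes "f \<in> grhom A B d"
  shows grhom_outside: "v \<notin> carr A \<Longrightarrow> f v = 0"
    and grhom_carr: "v \<in> carr A \<Longrightarrow> f v \<in> carr B"
    and grhom_add: "u \<in> carr A \<Longrightarrow> v \<in> carr A \<Longrightarrow> f (u + v) = f u + f v"
    and grhom_smult: "v \<in> carr A \<Longrightarrow> f (smult A p v) = smult B p (f v)"
    and grhom_comp: "v \<in> comp A e \<Longrightarrow> f v \<in> comp B (e + d)"
  using assms unfolding grhom_def by auto

lemma grhom_zero: "graded_module A \<Longrightarrow> f \<in> grhom A B d \<Longrightarrow> f 0 = 0"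
  using grhom_add[of f A B d 0 0] by (simp add: carr_zero)

lemma grhom_sum:
  assumes A: "graded_module A" and f: "f \<in> grhom A B d" and "\<And>j. j \<in> J \<Longrightarrow> v j \<in> carr A"
  shows "f (sum v J) = (\<Sum>j\<in>J. f (v j))"
  using assms(3)
  by (induction J rule: infinite_finite_induct)
    (auto simp: grhom_zero[OF A f] grhom_add[OF f] carr_sum[OF A])

lemma zero_in_grhom: "graded_module B \<Longrightarrow> 0 \<in> grhom A B d"
  unfolding grhom_def
  by (simp add: carr_zero comp_zero Modules.module.scale_zero_right[OF graded_module_module])

lemma grhom_minus:
  assumes B: "graded_module B" and f: "f \<in> grhom A B d" and g: "g \<in> grhom A B d"
  shows "f - g \<in> grhom A B d"
  unfolding grhom_def
  by (auto simp: grhomD[OF f] grhomD[OF g] carr_diff[OF B] comp_diff[OF B]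
      Modules.module.scale_right_diff_distrib[OF graded_module_module[OF B]])

lemma grhom_compose:
  assumes B: "graded_module B" and f: "f \<in> grhom A B d" and g: "g \<in> grhom B C e"
  shows "g \<circ> f \<in> grhom A C (d + e)"
  unfolding grhom_def mem_Collect_eq
proof (intro conjI allI ballI impI)
  fix a v assume "v \<in> comp A a"
  then show "(g \<circ> f) v \<in> comp C (a + (d + e))"
    using grhom_comp[OF g grhom_comp[OF f]] by (simp add: add.assoc)
qed (simp_all add: grhomD[OF f] grhom_zero[OF B g] grhom_carr[OF g] grhom_add[OF g]
  grhom_smult[OF g])

lemmas grhom_precompose = grhom_compose[where d = 0, simplified]

lemma zero_compose: "0 \<circ> f = 0" for f :: "'a \<Rightarrow> 'b"
  by (simp add: fun_eq_iff)

lemma minus_compose: "(f - g) \<circ> h = (f \<circ> h) - (g \<circ> h)" for f g :: "'b \<Rightarrow> 'c::ab_group_add"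
  by (simp add: fun_eq_iff)

lemma plus_compose: "(f + g) \<circ> h = (f \<circ> h) + (g \<circ> h)" for f g :: "'b \<Rightarrow> 'c::ab_group_add"
  by (simp add: fun_eq_iff)

lemma grhom_compose_zero: "graded_module B \<Longrightarrow> g \<in> grhom B C e \<Longrightarrow> g \<circ> 0 = 0"
  by (simp add: fun_eq_iff grhom_zero)

lemma grhom_compose_plus:
  assumes B: "graded_module B" and g: "g \<in> grhom B C e"
    and f: "f \<in> grhom A B d" and h: "h \<in> grhom A B d"
  shows "g \<circ> (f + h) = (g \<circ> f) + (g \<circ> h)"
proof
  fix v show "(g \<circ> (f + h)) v = ((g \<circ> f) + (g \<circ> h)) v"
    by (cases "v \<in> carr A")
      (simp_all add: grhom_add[OF g] grhomD[OF f] grhomD[OF h] grhom_zero[OF B g])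
qed

lemma grhom_compose_minus:
  assumes B: "graded_module B" and g: "g \<in> grhom B C e"
    and f: "f \<in> grhom A B d" and h: "h \<in> grhom A B d"
  shows "g \<circ> (f - h) = (g \<circ> f) - (g \<circ> h)"
  using grhom_compose_plus[OF B g grhom_minus[OF B f h] h] by (simp add: algebra_simps)

definition grhom_id :: "('r, 'a::ab_group_add) grmod \<Rightarrow> 'a \<Rightarrow> 'a" where
  "grhom_id A = (\<lambda>v. if v \<in> carr A then v else 0)"

lemma grhom_id_in_grhom: "graded_module A \<Longrightarrow> grhom_id A \<in> grhom A A 0"
  by (auto simp: grhom_def grhom_id_def carr_add carr_smult comp_subset_carr)

lemma grhom_compose_id: "graded_module A \<Longrightarrow> f \<in> grhom A B d \<Longrightarrow> f \<circ> grhom_id A = f"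
  by (simp add: fun_eq_iff grhom_id_def grhom_zero grhom_outside)

lemma id_compose_grhom: "graded_module B \<Longrightarrow> f \<in> grhom A B d \<Longrightarrow> grhom_id B \<circ> f = f"
  using grhom_carr grhom_outside by (fastforce simp: fun_eq_iff grhom_id_def)

lemma homogeneous_preimage:
  assumes A: "graded_module A" and B: "graded_module B" and g: "g \<in> grhom A B 0"
    and a: "a \<in> carr A" "g a \<in> comp B d"
  shows "\<exists>a'\<in>comp A d. g a' = g a"
proof -
  obtain f where f: "\<And>e. f e \<in> comp A e" "finite {e. f e \<noteq> 0}" "a = (\<Sum>e | f e \<noteq> 0. f e)"
    using homogeneous_decomposition_ex1[OF A a(1)] unfolding homogeneous_decomposition_def by blast
  have "homogeneous_decomposition B (g a) (\<lambda>e. g (f e))"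
  proof (rule homogeneous_decompositionI[OF _ f(2)])
    show "g (f e) \<in> comp B e" for e using grhom_comp[OF g f(1)[of e]] by simp
    show "g a = (\<Sum>e | f e \<noteq> 0. g (f e))"
      unfolding f(3) by (rule grhom_sum[OF A g]) (auto intro: comp_subset_carr[OF A f(1)])
  qed (simp add: grhom_zero[OF A g])
  from homogeneous_decomposition_component[OF B a(2) this] f(1) show ?thesis by blast
qed

section \<open>Graded free modules\<close>

lemma module_free: "Modules.module (smult (free_grmod ds))"
  by unfold_locales (auto simp: free_grmod_def fun_eq_iff algebra_simps)

lemma sum_fun_apply: "(\<Sum>x\<in>A. f x) y = (\<Sum>x\<in>A. f x y)"
  by (induction A rule: infinite_finite_induct) auto

lemma graded_module_free [simp]:
  "graded_module (free_grmod ds :: (('x::finite, 'k::field) mpoly, nat \<Rightarrow> ('x, 'k) mpoly) grmod)"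
proof (rule graded_moduleI[where proj = "\<lambda>d v j. hom_part (d - ds ! j) (v j)"])
  show "Modules.module.subspace (smult (free_grmod ds)) (carr (free_grmod ds))"
    unfolding Modules.module.subspace_def[OF module_free] by (auto simp: free_grmod_def)
next
  fix a b :: int and p :: "('x, 'k) mpoly" and v :: "nat \<Rightarrow> ('x, 'k) mpoly"
  assume "p \<in> mpoly_comp a" "v \<in> comp (free_grmod ds) b"
  then show "smult (free_grmod ds) p v \<in> comp (free_grmod ds) (a + b)"
    using mult_in_mpoly_comp[of p a] by (fastforce simp: free_grmod_def add_diff_eq[symmetric])
next
  fix d e :: int and v :: "nat \<Rightarrow> ('x, 'k) mpoly"
  assume v: "v \<in> comp (free_grmod ds) e"
  have "hom_part (d - ds ! j) (v j) = (if d = e then v j else 0)" for j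
    using v hom_part_mpoly_comp[of "v j" "e - ds ! j" "d - ds ! j"]
    by (cases "j < length ds") (auto simp: free_grmod_def)
  then show "(\<lambda>j. hom_part (d - ds ! j) (v j)) = (if d = e then v else 0)"
    by auto
next
  fix v :: "nat \<Rightarrow> ('x, 'k) mpoly" assume v: "v \<in> carr (free_grmod ds)"
  let ?S = "\<Union>j<length ds. (\<lambda>m. int (monom_deg m) + ds ! j) ` Poly_Mapping.keys (v j)"
  have "(\<Sum>d\<in>?S. hom_part (d - ds ! j) (v j)) = v j" for j
  proof (cases "j < length ds")
    case True
    then show ?thesis by (intro sum_hom_part) auto
  next
    case False
    then show ?thesis using v by (simp add: free_grmod_def)
  qed
  then show "\<exists>S. finite S \<and> v = (\<Sum>d\<in>S. (\<lambda>j. hom_part (d - ds ! j) (v j)))"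
    by (intro exI[of _ ?S]) (auto simp: fun_eq_iff sum_fun_apply)
qed (rule module_free, auto simp: free_grmod_def diff_in_mpoly_comp hom_part_add)

definition basis_vec :: "nat \<Rightarrow> nat \<Rightarrow> ('x, 'k::comm_ring_1) mpoly" where
  "basis_vec j = (\<lambda>l. if l = j then 1 else 0)"

lemma basis_vec_comp: "j < length ds \<Longrightarrow> basis_vec j \<in> comp (free_grmod ds) (ds ! j)"
  by (auto simp: free_grmod_def basis_vec_def one_in_mpoly_comp)

lemmas basis_vec_carr = comp_subset_carr[OF graded_module_free basis_vec_comp]

lemma free_expansion:
  assumes "v \<in> carr (free_grmod ds)"
  shows "(\<Sum>j<length ds. smult (free_grmod ds) (v j) (basis_vec j)) = v"
proof
  fix l
  have "(\<Sum>j<length ds. v j * (if l = j then 1 else 0)) = (\<Sum>j<length ds. if l = j then v l else 0)"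
    by (rule sum.cong) auto
  also have "\<dots> = v l" using assms by (auto simp: free_grmod_def not_less)
  finally show "(\<Sum>j<length ds. smult (free_grmod ds) (v j) (basis_vec j)) l = v l"
    by (simp add: sum_fun_apply free_grmod_def basis_vec_def)
qed

lemma grhom_free_expansion:
  assumes f: "f \<in> grhom (free_grmod ds) B d" and v: "v \<in> carr (free_grmod ds)"
  shows "f v = (\<Sum>j<length ds. smult B (v j) (f (basis_vec j)))"
proof -
  have "f v = f (\<Sum>j<length ds. smult (free_grmod ds) (v j) (basis_vec j))"
    by (simp add: free_expansion[OF v])
  also have "\<dots> = (\<Sum>j<length ds. smult B (v j) (f (basis_vec j)))"
    by (subst grhom_sum[OF graded_module_free f])
      (auto simp: grhom_smult[OF f] basis_vec_carr carr_smult)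
  finally show ?thesis .
qed

lemma grhom_free_eqI:
  assumes f: "f \<in> grhom (free_grmod ds) B d" and g: "g \<in> grhom (free_grmod ds) B d"
    and eq: "\<And>j. j < length ds \<Longrightarrow> f (basis_vec j) = g (basis_vec j)"
  shows "f = g"
proof
  fix v show "f v = g v"
    by (cases "v \<in> carr (free_grmod ds)")
      (simp_all add: grhom_free_expansion[OF f] grhom_free_expansion[OF g] eq
        grhom_outside[OF f] grhom_outside[OF g])
qed

definition free_extension :: "(('x::finite, 'k::field) mpoly, 'm::ab_group_add) grmod \<Rightarrow> int list \<Rightarrow>
    (nat \<Rightarrow> 'm) \<Rightarrow> (nat \<Rightarrow> ('x, 'k) mpoly) \<Rightarrow> 'm" where
  "free_extension A ds a v =
     (if v \<in> carr (free_grmod ds) then (\<Sum>j<length ds. smult A (v j) (a j)) else 0)"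

lemma free_extension_in_grhom:
  fixes A :: "(('x::finite, 'k::field) mpoly, 'm::ab_group_add) grmod"
  assumes A: "graded_module A" and a: "\<And>j. j < length ds \<Longrightarrow> a j \<in> comp A (ds ! j + d)"
  shows "free_extension A ds a \<in> grhom (free_grmod ds) A d"
  unfolding grhom_def mem_Collect_eq
proof (intro conjI allI ballI impI)
  interpret A: Modules.module "smult A" by (rule graded_module_module[OF A])
  fix u v :: "nat \<Rightarrow> ('x, 'k) mpoly" and p :: "('x, 'k) mpoly"
  assume v: "v \<in> carr (free_grmod ds)"
  show "free_extension A ds a v \<in> carr A"
    using v by (auto simp: free_extension_def comp_subset_carr[OF A a]
        intro!: carr_sum[OF A] carr_smult[OF A])
  show "free_extension A ds a (smult (free_grmod ds) p v) = smult A p (free_extension A ds a v)"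
    using v carr_smult[OF graded_module_free v, of p]
    by (simp add: free_extension_def A.scale_sum_right) (simp add: free_grmod_def)
  assume "u \<in> carr (free_grmod ds)"
  with v show "free_extension A ds a (u + v) = free_extension A ds a u + free_extension A ds a v"
    by (simp add: free_extension_def carr_add A.scale_left_distrib sum.distrib)
next
  fix e and v :: "nat \<Rightarrow> ('x, 'k) mpoly" assume v: "v \<in> comp (free_grmod ds) e"
  have "smult A (v j) (a j) \<in> comp A (e + d)" if "j < length ds" for j
    using comp_smult[OF A _ a[OF that], of "v j" "e - ds ! j"] v that
    by (simp add: free_grmod_def add.assoc[symmetric])
  then show "free_extension A ds a v \<in> comp A (e + d)"
    by (auto simp: free_extension_def comp_zero[OF A] intro!: comp_sum[OF A])
qed (simp add: free_extension_def)

lemma free_extension_basis_vec: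
  assumes A: "graded_module A" and j: "j < length ds"
  shows "free_extension A ds a (basis_vec j) = a j"
proof -
  interpret A: Modules.module "smult A" by (rule graded_module_module[OF A])
  have "free_extension A ds a (basis_vec j) = (\<Sum>l<length ds. smult A (basis_vec j l) (a l))"
    by (simp add: free_extension_def basis_vec_carr[OF j])
  also have "\<dots> = (\<Sum>l<length ds. if l = j then a l else 0)"
    by (rule sum.cong) (simp_all add: basis_vec_def)
  finally show ?thesis using j by simp
qed

lemma free_lift:
  assumes A: "graded_module A" and B: "graded_module B"
    and f: "f \<in> grhom (free_grmod ds) B d" and g: "g \<in> grhom A B 0"
    and im: "f ` carr (free_grmod ds) \<subseteq> g ` carr A"
  shows "\<exists>h\<in>grhom (free_grmod ds) A d. g \<circ> h = f"
proof -
  have "\<exists>a\<in>comp A (ds ! j + d). g a = f (basis_vec j)" if j: "j < length ds" for j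
  proof -
    obtain a where "a \<in> carr A" "g a = f (basis_vec j)"
      using im basis_vec_carr[OF j] by (metis image_iff image_subset_iff)
    then show ?thesis
      using homogeneous_preimage[OF A B g, of a] grhom_comp[OF f basis_vec_comp[OF j]] by metis
  qed
  then obtain a where a: "\<And>j. j < length ds \<Longrightarrow> a j \<in> comp A (ds ! j + d)"
    "\<And>j. j < length ds \<Longrightarrow> g (a j) = f (basis_vec j)" by metis
  let ?h = "free_extension A ds a"
  have h: "?h \<in> grhom (free_grmod ds) A d" by (rule free_extension_in_grhom[OF A a(1)])
  then have "g \<circ> ?h \<in> grhom (free_grmod ds) B d" using grhom_compose[OF A _ g] by fastforce
  then have "g \<circ> ?h = f"
    by (rule grhom_free_eqI[OF _ f]) (simp add: free_extension_basis_vec[OF A] a(2))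
  with h show ?thesis by blast
qed

section \<open>Comparison of graded free resolutions\<close>

lemma graded_free_resolutionD:
  assumes "graded_free_resolution M P"
  shows aug_grhom: "aug P \<in> grhom (term_of P 0) M 0"
    and diff_grhom: "diff P i \<in> grhom (term_of P (Suc i)) (term_of P i) 0"
    and aug_surj: "aug P ` carr (term_of P 0) = carr M"
    and aug_exact: "{v \<in> carr (term_of P 0). aug P v = 0} = diff P 0 ` carr (term_of P (Suc 0))"
    and diff_exact: "{v \<in> carr (term_of P (Suc i)). diff P i v = 0} =
      diff P (Suc i) ` carr (term_of P (Suc (Suc i)))"
  using assms by (simp_all add: graded_free_resolution_def)

lemma aug_compose_diff:
  assumes P: "graded_free_resolution M P"
  shows "aug P \<circ> diff P 0 = 0"
proof
  fix v show "(aug P \<circ> diff P 0) v = 0 v"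
    using aug_exact[OF P] grhom_outside[OF diff_grhom[OF P], of v 0]
      grhom_zero[OF graded_module_free aug_grhom[OF P]]
    by (cases "v \<in> carr (term_of P (Suc 0))") auto
qed

lemma diff_compose_diff:
  assumes P: "graded_free_resolution M P"
  shows "diff P i \<circ> diff P (Suc i) = 0"
proof
  fix v show "(diff P i \<circ> diff P (Suc i)) v = 0 v"
    using diff_exact[OF P, of i] grhom_outside[OF diff_grhom[OF P], of v "Suc i"]
      grhom_zero[OF graded_module_free diff_grhom[OF P]]
    by (cases "v \<in> carr (term_of P (Suc (Suc i)))") auto
qed

definition maps_to_cycles :: "(('x::finite, 'k::field) mpoly, 'm::ab_group_add) gfree_complex \<Rightarrow>
    nat \<Rightarrow> ('a \<Rightarrow> nat \<Rightarrow> ('x, 'k) mpoly) \<Rightarrow> bool" where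
  "maps_to_cycles P i f \<longleftrightarrow>
     (case i of 0 \<Rightarrow> aug P \<circ> f = 0 | Suc j \<Rightarrow> diff P j \<circ> f = 0)"

lemma resolution_lift:
  assumes P: "graded_free_resolution M P"
    and f: "f \<in> grhom (free_grmod ds) (term_of P i) d" and cycles: "maps_to_cycles P i f"
  shows "\<exists>h\<in>grhom (free_grmod ds) (term_of P (Suc i)) d. diff P i \<circ> h = f"
proof (rule free_lift[OF graded_module_free graded_module_free f diff_grhom[OF P]])
  show "f ` carr (free_grmod ds) \<subseteq> diff P i ` carr (term_of P (Suc i))"
  proof (cases i)
    case 0
    then show ?thesis
      using cycles grhom_carr[OF f] aug_exact[OF P] by (auto simp: maps_to_cycles_def fun_eq_iff)
  next
    case (Suc j)
    then show ?thesis
      using cycles grhom_carr[OF f] diff_exact[OF P, of j]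
      by (auto simp: maps_to_cycles_def fun_eq_iff)
  qed
qed

definition chain_map :: "(('x::finite, 'k::field) mpoly, 'm::ab_group_add) gfree_complex \<Rightarrow>
    (('x, 'k) mpoly, 'm) gfree_complex \<Rightarrow>
    (nat \<Rightarrow> (nat \<Rightarrow> ('x, 'k) mpoly) \<Rightarrow> nat \<Rightarrow> ('x, 'k) mpoly) \<Rightarrow> bool" where
  "chain_map Q P \<phi> \<longleftrightarrow> (\<forall>i. \<phi> i \<in> grhom (term_of Q i) (term_of P i) 0) \<and>
     aug P \<circ> \<phi> 0 = aug Q \<and> (\<forall>i. diff P i \<circ> \<phi> (Suc i) = \<phi> i \<circ> diff Q i)"

lemma chain_mapD:
  assumes "chain_map Q P \<phi>"
  shows chain_map_grhom: "\<phi> i \<in> grhom (term_of Q i) (term_of P i) 0"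
    and chain_map_aug: "aug P \<circ> \<phi> 0 = aug Q"
    and chain_map_diff: "diff P i \<circ> \<phi> (Suc i) = \<phi> i \<circ> diff Q i"
  using assms unfolding chain_map_def by auto

lemma chain_map_exists:
  assumes M: "graded_module M"
    and Q: "graded_free_resolution M Q" and P: "graded_free_resolution M P"
  shows "\<exists>\<phi>. chain_map Q P \<phi>"
proof -
  define lift where "lift n f \<longleftrightarrow> f \<in> grhom (term_of Q n) (term_of P n) 0 \<and>
      maps_to_cycles P n (f \<circ> diff Q n) \<and> (n = 0 \<longrightarrow> aug P \<circ> f = aug Q)" for n f
  have "\<exists>\<phi>. \<forall>n. lift n (\<phi> n) \<and> diff P n \<circ> \<phi> (Suc n) = \<phi> n \<circ> diff Q n"
  proof (rule dependent_nat_choice)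
    obtain f where f: "f \<in> grhom (term_of Q 0) (term_of P 0) 0" "aug P \<circ> f = aug Q"
      using free_lift[OF graded_module_free M aug_grhom[OF Q] aug_grhom[OF P]]
      by (auto simp: aug_surj[OF P] aug_surj[OF Q])
    have "aug P \<circ> (f \<circ> diff Q 0) = 0"
      by (simp add: f(2) aug_compose_diff[OF Q] flip: comp_assoc)
    with f show "\<exists>f. lift 0 f" by (auto simp: lift_def maps_to_cycles_def)
  next
    fix f n assume f: "lift n f"
    then have f_grhom: "f \<in> grhom (term_of Q n) (term_of P n) 0" by (simp add: lift_def)
    have fd: "f \<circ> diff Q n \<in> grhom (term_of Q (Suc n)) (term_of P n) 0"
      by (rule grhom_precompose[OF graded_module_free diff_grhom[OF Q] f_grhom])
    with f obtain g where g: "g \<in> grhom (term_of Q (Suc n)) (term_of P (Suc n)) 0"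
      "diff P n \<circ> g = f \<circ> diff Q n"
      using resolution_lift[OF P fd] by (auto simp: lift_def)
    have "diff P n \<circ> (g \<circ> diff Q (Suc n)) = f \<circ> (diff Q n \<circ> diff Q (Suc n))"
      by (simp add: g(2) flip: comp_assoc)
    also have "\<dots> = 0"
      by (simp add: diff_compose_diff[OF Q] grhom_compose_zero[OF graded_module_free f_grhom])
    finally show "\<exists>g. lift (Suc n) g \<and> diff P n \<circ> g = f \<circ> diff Q n"
      using g by (auto simp: lift_def maps_to_cycles_def)
  qed
  then obtain \<phi> where \<phi>: "\<And>n. lift n (\<phi> n)" "\<And>n. diff P n \<circ> \<phi> (Suc n) = \<phi> n \<circ> diff Q n"
    by blast
  then have "chain_map Q P \<phi>"
    unfolding chain_map_def by (simp add: lift_def)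
  then show ?thesis by blast
qed

lemma chain_map_compose:
  assumes \<phi>: "chain_map Q P \<phi>" and \<psi>: "chain_map P S \<psi>"
  shows "chain_map Q S (\<lambda>i. \<psi> i \<circ> \<phi> i)"
  unfolding chain_map_def
proof (intro conjI allI)
  fix i
  show "\<psi> i \<circ> \<phi> i \<in> grhom (term_of Q i) (term_of S i) 0"
    by (rule grhom_precompose[OF graded_module_free chain_map_grhom[OF \<phi>] chain_map_grhom[OF \<psi>]])
  have "diff S i \<circ> (\<psi> (Suc i) \<circ> \<phi> (Suc i)) = \<psi> i \<circ> (diff P i \<circ> \<phi> (Suc i))"
    by (simp add: chain_map_diff[OF \<psi>] flip: comp_assoc)
  then show "diff S i \<circ> (\<psi> (Suc i) \<circ> \<phi> (Suc i)) = \<psi> i \<circ> \<phi> i \<circ> diff Q i"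
    by (simp add: chain_map_diff[OF \<phi>] comp_assoc)
qed (simp add: chain_map_aug[OF \<phi>] chain_map_aug[OF \<psi>] flip: comp_assoc)

lemma chain_map_id:
  assumes Q: "graded_free_resolution M Q"
  shows "chain_map Q Q (\<lambda>i. grhom_id (term_of Q i))"
  unfolding chain_map_def
  by (simp add: grhom_id_in_grhom id_compose_grhom[OF graded_module_free diff_grhom[OF Q]]
      grhom_compose_id[OF graded_module_free diff_grhom[OF Q]]
      grhom_compose_id[OF graded_module_free aug_grhom[OF Q]])

definition homotopy_tail :: "(('x::finite, 'k::field) mpoly, 'm) gfree_complex \<Rightarrow>
    (nat \<Rightarrow> (nat \<Rightarrow> ('x, 'k) mpoly) \<Rightarrow> nat \<Rightarrow> ('x, 'k) mpoly) \<Rightarrow>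
    nat \<Rightarrow> (nat \<Rightarrow> ('x, 'k) mpoly) \<Rightarrow> nat \<Rightarrow> ('x, 'k) mpoly" where
  "homotopy_tail Q h i = (case i of 0 \<Rightarrow> 0 | Suc j \<Rightarrow> h j \<circ> diff Q j)"

definition chain_homotopy :: "(('x::finite, 'k::field) mpoly, 'm) gfree_complex \<Rightarrow>
    (('x, 'k) mpoly, 'm) gfree_complex \<Rightarrow>
    (nat \<Rightarrow> (nat \<Rightarrow> ('x, 'k) mpoly) \<Rightarrow> nat \<Rightarrow> ('x, 'k) mpoly) \<Rightarrow>
    (nat \<Rightarrow> (nat \<Rightarrow> ('x, 'k) mpoly) \<Rightarrow> nat \<Rightarrow> ('x, 'k) mpoly) \<Rightarrow>
    (nat \<Rightarrow> (nat \<Rightarrow> ('x, 'k) mpoly) \<Rightarrow> nat \<Rightarrow> ('x, 'k) mpoly) \<Rightarrow> bool" where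
  "chain_homotopy Q P \<phi> \<theta> h \<longleftrightarrow> (\<forall>i. h i \<in> grhom (term_of Q i) (term_of P (Suc i)) 0) \<and>
     (\<forall>i. \<phi> i - \<theta> i = (diff P i \<circ> h i) + homotopy_tail Q h i)"

lemma chain_homotopyD:
  assumes "chain_homotopy Q P \<phi> \<theta> h"
  shows chain_homotopy_grhom: "h i \<in> grhom (term_of Q i) (term_of P (Suc i)) 0"
    and chain_homotopy_diff: "\<phi> i - \<theta> i = (diff P i \<circ> h i) + homotopy_tail Q h i"
  using assms unfolding chain_homotopy_def by auto

lemma homotopy_tail_grhom:
  assumes Q: "graded_free_resolution M Q" and h: "chain_homotopy Q P \<phi> \<theta> h"
  shows "homotopy_tail Q h i \<in> grhom (term_of Q i) (term_of P i) 0"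
  using grhom_precompose[OF graded_module_free diff_grhom[OF Q] chain_homotopy_grhom[OF h]]
  by (auto simp: homotopy_tail_def zero_in_grhom split: nat.split)

lemma null_homotopy_step:
  assumes Q: "graded_free_resolution M Q" and P: "graded_free_resolution M P"
    and \<delta>: "\<And>i. \<delta> i \<in> grhom (term_of Q i) (term_of P i) 0"
    and diff: "\<And>i. diff P i \<circ> \<delta> (Suc i) = \<delta> i \<circ> diff Q i"
    and f: "f \<in> grhom (term_of Q n) (term_of P (Suc n)) 0"
    and boundary: "(\<delta> n - (diff P n \<circ> f)) \<circ> diff Q n = 0"
  shows "\<exists>g\<in>grhom (term_of Q (Suc n)) (term_of P (Suc (Suc n))) 0.
    diff P (Suc n) \<circ> g = \<delta> (Suc n) - (f \<circ> diff Q n) \<and>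
    (\<delta> (Suc n) - (diff P (Suc n) \<circ> g)) \<circ> diff Q (Suc n) = 0"
proof -
  let ?u = "\<delta> (Suc n) - (f \<circ> diff Q n)"
  have fd: "f \<circ> diff Q n \<in> grhom (term_of Q (Suc n)) (term_of P (Suc n)) 0"
    by (rule grhom_precompose[OF graded_module_free diff_grhom[OF Q] f])
  have "diff P n \<circ> ?u = (diff P n \<circ> \<delta> (Suc n)) - (diff P n \<circ> (f \<circ> diff Q n))"
    by (rule grhom_compose_minus[OF graded_module_free diff_grhom[OF P] \<delta> fd])
  also have "\<dots> = (\<delta> n - (diff P n \<circ> f)) \<circ> diff Q n"
    by (simp add: diff minus_compose comp_assoc)
  finally have "maps_to_cycles P (Suc n) ?u" by (simp add: maps_to_cycles_def boundary)
  then obtain g where g: "g \<in> grhom (term_of Q (Suc n)) (term_of P (Suc (Suc n))) 0"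
    "diff P (Suc n) \<circ> g = ?u"
    using resolution_lift[OF P grhom_minus[OF graded_module_free \<delta> fd]] by blast
  have "(\<delta> (Suc n) - (diff P (Suc n) \<circ> g)) \<circ> diff Q (Suc n) = f \<circ> (diff Q n \<circ> diff Q (Suc n))"
    by (simp add: g(2) comp_assoc)
  also have "\<dots> = 0"
    by (simp add: diff_compose_diff[OF Q] grhom_compose_zero[OF graded_module_free f])
  finally show ?thesis using g by blast
qed

lemma null_homotopy_exists:
  assumes Q: "graded_free_resolution M Q" and P: "graded_free_resolution M P"
    and \<delta>: "\<And>i. \<delta> i \<in> grhom (term_of Q i) (term_of P i) 0"
    and aug: "aug P \<circ> \<delta> 0 = 0" and diff: "\<And>i. diff P i \<circ> \<delta> (Suc i) = \<delta> i \<circ> diff Q i"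
  shows "\<exists>h. (\<forall>i. h i \<in> grhom (term_of Q i) (term_of P (Suc i)) 0) \<and>
    (\<forall>i. \<delta> i = (diff P i \<circ> h i) + homotopy_tail Q h i)"
proof -
  define partial where "partial n f \<longleftrightarrow> f \<in> grhom (term_of Q n) (term_of P (Suc n)) 0 \<and>
      (\<delta> n - (diff P n \<circ> f)) \<circ> diff Q n = 0 \<and> (n = 0 \<longrightarrow> diff P 0 \<circ> f = \<delta> 0)" for n f
  have "\<exists>h. \<forall>n. partial n (h n) \<and> diff P (Suc n) \<circ> h (Suc n) = \<delta> (Suc n) - (h n \<circ> diff Q n)"
  proof (rule dependent_nat_choice)
    obtain f where "f \<in> grhom (term_of Q 0) (term_of P (Suc 0)) 0" "diff P 0 \<circ> f = \<delta> 0"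
      using resolution_lift[OF P \<delta>[of 0]] aug by (auto simp: maps_to_cycles_def)
    then have "partial 0 f" by (simp add: partial_def zero_compose)
    then show "\<exists>f. partial 0 f" by blast
  next
    fix f n assume "partial n f"
    then show "\<exists>g. partial (Suc n) g \<and> diff P (Suc n) \<circ> g = \<delta> (Suc n) - (f \<circ> diff Q n)"
      using null_homotopy_step[OF Q P \<delta> diff, of f n] unfolding partial_def by blast
  qed
  then obtain h where h: "\<And>n. partial n (h n)"
    "\<And>n. diff P (Suc n) \<circ> h (Suc n) = \<delta> (Suc n) - (h n \<circ> diff Q n)" by blast
  have "\<delta> i = (diff P i \<circ> h i) + homotopy_tail Q h i" for i
    using h(1)[of 0] h(2) by (cases i) (simp_all add: partial_def homotopy_tail_def)
  with h(1) show ?thesis unfolding partial_def by blast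
qed

lemma chain_homotopy_exists:
  assumes Q: "graded_free_resolution M Q" and P: "graded_free_resolution M P"
    and \<phi>: "chain_map Q P \<phi>" and \<theta>: "chain_map Q P \<theta>"
  shows "\<exists>h. chain_homotopy Q P \<phi> \<theta> h"
  unfolding chain_homotopy_def
proof (rule null_homotopy_exists[OF Q P])
  note grhom = chain_map_grhom[OF \<phi>] chain_map_grhom[OF \<theta>]
  show "\<phi> i - \<theta> i \<in> grhom (term_of Q i) (term_of P i) 0" for i
    by (rule grhom_minus[OF graded_module_free grhom])
  show "aug P \<circ> (\<phi> 0 - \<theta> 0) = 0"
    by (simp add: grhom_compose_minus[OF graded_module_free aug_grhom[OF P] grhom]
        chain_map_aug[OF \<phi>] chain_map_aug[OF \<theta>])
  show "diff P i \<circ> (\<phi> (Suc i) - \<theta> (Suc i)) = (\<phi> i - \<theta> i) \<circ> diff Q i" for i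
    by (simp add: grhom_compose_minus[OF graded_module_free diff_grhom[OF P] grhom]
        chain_map_diff[OF \<phi>] chain_map_diff[OF \<theta>] minus_compose)
qed

section \<open>Quotients of additive groups\<close>

definition is_add_subgroup :: "'a::ab_group_add set \<Rightarrow> bool" where
  "is_add_subgroup Z \<longleftrightarrow> 0 \<in> Z \<and> (\<forall>a\<in>Z. \<forall>b\<in>Z. a - b \<in> Z)"

lemma is_add_subgroup_zero: "is_add_subgroup Z \<Longrightarrow> 0 \<in> Z"
  by (simp add: is_add_subgroup_def)

lemma is_add_subgroup_uminus: "is_add_subgroup Z \<Longrightarrow> a \<in> Z \<Longrightarrow> - a \<in> Z"
  by (metis diff_0 is_add_subgroup_def)

lemma is_add_subgroup_minus: "is_add_subgroup Z \<Longrightarrow> a \<in> Z \<Longrightarrow> b \<in> Z \<Longrightarrow> a - b \<in> Z"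
  by (simp add: is_add_subgroup_def)

lemma is_add_subgroup_plus: "is_add_subgroup Z \<Longrightarrow> a \<in> Z \<Longrightarrow> b \<in> Z \<Longrightarrow> a + b \<in> Z"
  by (metis diff_minus_eq_add is_add_subgroup_def is_add_subgroup_uminus)

lemma additive_group_simps [simp]:
  "carrier (additive_group Z) = Z" "a \<otimes>\<^bsub>additive_group Z\<^esub> b = a + b" "\<one>\<^bsub>additive_group Z\<^esub> = 0"
  by (simp_all add: additive_group_def)

lemma comm_group_additive_group:
  assumes Z: "is_add_subgroup Z" shows "comm_group (additive_group Z)"
proof (rule comm_groupI)
  fix a assume "a \<in> carrier (additive_group Z)"
  then show "\<exists>b\<in>carrier (additive_group Z). b \<otimes>\<^bsub>additive_group Z\<^esub> a = \<one>\<^bsub>additive_group Z\<^esub>"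
    using is_add_subgroup_uminus[OF Z] by (intro bexI[of _ "- a"]) simp_all
qed (use Z in \<open>auto simp: algebra_simps is_add_subgroup_plus is_add_subgroup_def\<close>)

lemma normal_additive_group:
  assumes Z: "is_add_subgroup Z" and B: "is_add_subgroup B" "B \<subseteq> Z"
  shows "B \<lhd> additive_group Z"
proof -
  interpret comm_group "additive_group Z" by (rule comm_group_additive_group[OF Z])
  have "group ((additive_group Z)\<lparr>carrier := B\<rparr>)"
    using comm_group.axioms(2)[OF comm_group_additive_group[OF B(1)]]
    by (simp add: additive_group_def)
  then have "subgroup B (additive_group Z)"
    using B(2) by (intro group_incl_imp_subgroup) simp_all
  then show ?thesis by (rule subgroup_imp_normal)
qed

lemma additive_cosets_eq_iff:
  assumes B: "is_add_subgroup B"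
  shows "B #>\<^bsub>additive_group Z\<^esub> z = B #>\<^bsub>additive_group Z\<^esub> w \<longleftrightarrow> z - w \<in> B"
proof -
  have mem: "x \<in> B #>\<^bsub>additive_group Z\<^esub> y \<longleftrightarrow> x - y \<in> B" for x y
    by (auto simp: r_coset_def intro!: bexI[of _ "x - y"])
  show ?thesis
  proof
    assume "B #>\<^bsub>additive_group Z\<^esub> z = B #>\<^bsub>additive_group Z\<^esub> w"
    then have "z - w \<in> B \<longleftrightarrow> z - z \<in> B" unfolding mem[symmetric] by simp
    then show "z - w \<in> B" using is_add_subgroup_zero[OF B] by simp
  next
    assume zw: "z - w \<in> B"
    have "x - z \<in> B \<longleftrightarrow> x - w \<in> B" for x
      using is_add_subgroup_plus[OF B _ zw, of "x - z"] is_add_subgroup_minus[OF B _ zw, of "x - w"]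
      by auto
    then show "B #>\<^bsub>additive_group Z\<^esub> z = B #>\<^bsub>additive_group Z\<^esub> w"
      by (auto simp: set_eq_iff mem)
  qed
qed

lemma additive_coset_eq_subgroup_iff:
  "is_add_subgroup B \<Longrightarrow> B #>\<^bsub>additive_group Z\<^esub> z = B \<longleftrightarrow> z \<in> B"
  using additive_cosets_eq_iff[of B Z z 0] by (simp add: r_coset_def)

lemma nonzero_quotient_iff:
  fixes Z B :: "'a::ab_group_add set"
  assumes "is_add_subgroup Z" "is_add_subgroup B"
  shows "nonzero_group (additive_group Z Mod B) \<longleftrightarrow> \<not> Z \<subseteq> B"
proof -
  have "f ` Z = {B} \<longleftrightarrow> (\<forall>z\<in>Z. f z = B)" for f :: "'a \<Rightarrow> 'a set"
    using is_add_subgroup_zero[OF assms(1)] by blast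
  then show ?thesis
    by (simp add: nonzero_group_def carrier_FactGroup additive_coset_eq_subgroup_iff[OF assms(2)]
        subset_eq)
qed

lemma quotient_iso:
  assumes Z: "is_add_subgroup Z" "is_add_subgroup B" "B \<subseteq> Z"
    and Z': "is_add_subgroup Z'" "is_add_subgroup B'" "B' \<subseteq> Z'"
    and \<phi>: "\<And>z w. \<phi> (z + w) = \<phi> z + \<phi> w" "\<phi> ` Z \<subseteq> Z'" "\<phi> ` B \<subseteq> B'"
    and \<psi>: "\<psi> ` Z' \<subseteq> Z" "\<psi> ` B' \<subseteq> B"
    and \<psi>\<phi>: "\<And>z. z \<in> Z \<Longrightarrow> z - \<psi> (\<phi> z) \<in> B" and \<phi>\<psi>: "\<And>z. z \<in> Z' \<Longrightarrow> z - \<phi> (\<psi> z) \<in> B'"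
  shows "additive_group Z Mod B \<cong> additive_group Z' Mod B'"
proof -
  let ?G = "additive_group Z" and ?G' = "additive_group Z'"
  interpret B: normal B ?G by (rule normal_additive_group[OF Z])
  interpret B': normal B' ?G' by (rule normal_additive_group[OF Z'])
  define h where "h = (\<lambda>z. B' #>\<^bsub>?G'\<^esub> z) \<circ> \<phi>"
  have "\<phi> \<in> hom ?G ?G'" using \<phi> by (auto simp: hom_def)
  then have "h \<in> hom ?G (?G' Mod B')"
    unfolding h_def by (rule hom_compose[OF _ B'.r_coset_hom_Mod])
  then interpret h: group_hom ?G "?G' Mod B'" h
    using B.is_group B'.factorgroup_is_group by (simp add: group_hom_def group_hom_axioms_def)
  have coset_eq: "B' #>\<^bsub>?G'\<^esub> z = B' \<longleftrightarrow> z \<in> B'" if "z \<in> Z'" for z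
    using B'.coset_join1 B'.coset_join2 that B'.subgroup_axioms by auto
  have "\<phi> z \<in> B' \<longleftrightarrow> z \<in> B" if "z \<in> Z" for z
  proof
    assume "\<phi> z \<in> B'"
    then have "(z - \<psi> (\<phi> z)) + \<psi> (\<phi> z) \<in> B"
      using \<psi> by (intro is_add_subgroup_plus[OF Z(2) \<psi>\<phi>[OF that]]) auto
    then show "z \<in> B" by simp
  qed (use \<phi> in blast)
  then have kernel: "kernel ?G (?G' Mod B') h = B"
    using Z(3) by (auto simp: kernel_def h_def additive_coset_eq_subgroup_iff[OF Z'(2)])
  have "B' #>\<^bsub>?G'\<^esub> z = h (\<psi> z)" if "z \<in> Z'" for z
    using \<phi>\<psi>[OF that] by (simp add: h_def additive_cosets_eq_iff[OF Z'(2)])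
  then have "carrier (?G' Mod B') \<subseteq> h ` carrier ?G"
    unfolding carrier_FactGroup additive_group_simps using \<psi>(1) by blast
  moreover have "h ` carrier ?G \<subseteq> carrier (?G' Mod B')"
    using h.hom_closed by blast
  ultimately have "h ` carrier ?G = carrier (?G' Mod B')" by (rule antisym[rotated])
  from h.FactGroup_iso[OF this] show ?thesis by (simp add: kernel)
qed

lemma nonzero_quotient_iso_iff:
  assumes iso: "additive_group Z Mod B \<cong> additive_group Z' Mod B'"
    and Z: "is_add_subgroup Z" "is_add_subgroup B" "B \<subseteq> Z"
    and Z': "is_add_subgroup Z'" "is_add_subgroup B'" "B' \<subseteq> Z'"
  shows "nonzero_group (additive_group Z Mod B) \<longleftrightarrow> \<not> Z' \<subseteq> B'"
proof -
  note quotient_group = normal.factorgroup_is_group[OF normal_additive_group]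
  show ?thesis
    using isomorphic_group_triviality[OF iso quotient_group[OF Z] quotient_group[OF Z']]
      quotient_group[OF Z] quotient_group[OF Z'] nonzero_quotient_iff[OF Z'(1,2)]
    by (simp add: nonzero_group_def trivial_group_def)
qed

section \<open>Independence of Ext from the resolution\<close>

lemma graded_free_resolution_resolution_of:
  "graded_free_resolution M P \<Longrightarrow> graded_free_resolution M (resolution_of M)"
  unfolding resolution_of_def by (rule someI)

lemma is_add_subgroup_ext_cocycles:
  assumes N: "graded_module N" shows "is_add_subgroup (ext_cocycles P N i d)"
  by (simp add: is_add_subgroup_def ext_cocycles_def zero_in_grhom[OF N] grhom_minus[OF N]
      zero_compose minus_compose)

lemma is_add_subgroup_ext_coboundaries:
  assumes N: "graded_module N" shows "is_add_subgroup (ext_coboundaries P N i d)"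
proof (cases i)
  case (Suc j)
  have "(f \<circ> diff P j) - (g \<circ> diff P j) \<in> ext_coboundaries P N i d"
    if "f \<in> grhom (term_of P j) N d" "g \<in> grhom (term_of P j) N d" for f g
    using grhom_minus[OF N that] Suc by (simp add: ext_coboundaries_def flip: minus_compose)
  moreover have "0 \<in> ext_coboundaries P N i d"
    using zero_in_grhom[OF N] Suc
    by (auto simp: ext_coboundaries_def intro!: image_eqI[of _ _ 0] simp: zero_compose)
  ultimately show ?thesis
    using Suc by (auto simp: is_add_subgroup_def ext_coboundaries_def)
qed (simp add: is_add_subgroup_def ext_coboundaries_def)

lemma ext_coboundaries_subset_cocycles:
  assumes N: "graded_module N" and P: "graded_free_resolution M P"
  shows "ext_coboundaries P N i d \<subseteq> ext_cocycles P N i d"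
proof (cases i)
  case (Suc j)
  have "g \<circ> diff P j \<in> ext_cocycles P N i d" if g: "g \<in> grhom (term_of P j) N d" for g
    using grhom_precompose[OF graded_module_free diff_grhom[OF P] g] Suc
    by (simp add: ext_cocycles_def comp_assoc diff_compose_diff[OF P]
        grhom_compose_zero[OF graded_module_free g])
  then show ?thesis using Suc by (auto simp: ext_coboundaries_def)
qed (simp add: ext_coboundaries_def ext_cocycles_def zero_in_grhom[OF N] zero_compose)

lemma ext_cocycles_pullback:
  assumes \<phi>: "chain_map Q P \<phi>" and f: "f \<in> ext_cocycles P N i d"
  shows "f \<circ> \<phi> i \<in> ext_cocycles Q N i d"
proof -
  have f_grhom: "f \<in> grhom (term_of P i) N d" using f by (simp add: ext_cocycles_def)
  have "f \<circ> \<phi> i \<circ> diff Q i = (f \<circ> diff P i) \<circ> \<phi> (Suc i)"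
    by (simp add: comp_assoc chain_map_diff[OF \<phi>])
  also have "\<dots> = 0" using f by (simp add: ext_cocycles_def zero_compose)
  finally show ?thesis
    using grhom_precompose[OF graded_module_free chain_map_grhom[OF \<phi>] f_grhom]
    by (simp add: ext_cocycles_def)
qed

lemma ext_coboundaries_pullback:
  assumes \<phi>: "chain_map Q P \<phi>" and f: "f \<in> ext_coboundaries P N i d"
  shows "f \<circ> \<phi> i \<in> ext_coboundaries Q N i d"
proof (cases i)
  case (Suc j)
  then obtain g where g: "g \<in> grhom (term_of P j) N d" "f = g \<circ> diff P j"
    using f by (auto simp: ext_coboundaries_def)
  have "f \<circ> \<phi> i = (g \<circ> \<phi> j) \<circ> diff Q j"
    by (simp add: g(2) Suc comp_assoc chain_map_diff[OF \<phi>])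
  then show ?thesis
    using grhom_precompose[OF graded_module_free chain_map_grhom[OF \<phi>] g(1)] Suc
    by (auto simp: ext_coboundaries_def)
qed (use f in \<open>simp add: ext_coboundaries_def zero_compose\<close>)

lemma ext_homotopic:
  assumes Q: "graded_free_resolution M Q" and P: "graded_free_resolution M P"
    and \<phi>: "chain_map Q P \<phi>" and \<theta>: "chain_map Q P \<theta>"
    and f: "f \<in> ext_cocycles P N i d"
  shows "(f \<circ> \<phi> i) - (f \<circ> \<theta> i) \<in> ext_coboundaries Q N i d"
proof -
  obtain h where h: "chain_homotopy Q P \<phi> \<theta> h" using chain_homotopy_exists[OF Q P \<phi> \<theta>] ..
  note h_grhom = chain_homotopy_grhom[OF h]
  have f_grhom: "f \<in> grhom (term_of P i) N d" and fd: "f \<circ> diff P i = 0"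
    using f by (simp_all add: ext_cocycles_def)
  have "(f \<circ> \<phi> i) - (f \<circ> \<theta> i) = f \<circ> ((diff P i \<circ> h i) + homotopy_tail Q h i)"
    by (simp add: grhom_compose_minus[OF graded_module_free f_grhom chain_map_grhom[OF \<phi>]
          chain_map_grhom[OF \<theta>]] flip: chain_homotopy_diff[OF h])
  also have "\<dots> = (f \<circ> (diff P i \<circ> h i)) + (f \<circ> homotopy_tail Q h i)"
    by (rule grhom_compose_plus[OF graded_module_free f_grhom
          grhom_precompose[OF graded_module_free h_grhom diff_grhom[OF P]]
          homotopy_tail_grhom[OF Q h]])
  also have "\<dots> = f \<circ> homotopy_tail Q h i"
    by (simp add: fd zero_compose flip: comp_assoc)
  also have "\<dots> \<in> ext_coboundaries Q N i d"
  proof (cases i)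
    case 0
    then show ?thesis
      using grhom_compose_zero[OF graded_module_free f_grhom]
      by (simp add: homotopy_tail_def ext_coboundaries_def)
  next
    case (Suc j)
    then have "f \<circ> h j \<in> grhom (term_of Q j) N d"
      using grhom_precompose[OF graded_module_free h_grhom f_grhom[unfolded Suc]] by simp
    then show ?thesis
      using Suc by (simp add: homotopy_tail_def ext_coboundaries_def flip: comp_assoc)
  qed
  finally show ?thesis .
qed

lemma ext_chain_endomorphism:
  assumes Q: "graded_free_resolution M Q" and \<theta>: "chain_map Q Q \<theta>"
    and f: "f \<in> ext_cocycles Q N i d"
  shows "f - (f \<circ> \<theta> i) \<in> ext_coboundaries Q N i d"
proof -
  have "f \<in> grhom (term_of Q i) N d" using f by (simp add: ext_cocycles_def)
  then have "f \<circ> grhom_id (term_of Q i) = f" by (rule grhom_compose_id[OF graded_module_free])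
  then show ?thesis using ext_homotopic[OF Q Q chain_map_id[OF Q] \<theta> f] by simp
qed

theorem Ext_iso:
  assumes M: "graded_module M" and N: "graded_module N" and P: "graded_free_resolution M P"
  shows "Ext M N i d \<cong> additive_group (ext_cocycles P N i d) Mod ext_coboundaries P N i d"
proof -
  define Q where "Q = resolution_of M"
  have Q: "graded_free_resolution M Q"
    unfolding Q_def by (rule graded_free_resolution_resolution_of[OF P])
  obtain \<phi> where \<phi>: "chain_map Q P \<phi>" using chain_map_exists[OF M Q P] ..
  obtain \<psi> where \<psi>: "chain_map P Q \<psi>" using chain_map_exists[OF M P Q] ..
  show ?thesis
    unfolding Ext_def Q_def[symmetric]
  proof (rule quotient_iso[where \<phi> = "\<lambda>f. f \<circ> \<psi> i" and \<psi> = "\<lambda>f. f \<circ> \<phi> i"])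
    show "f - (f \<circ> \<psi> i \<circ> \<phi> i) \<in> ext_coboundaries Q N i d" if "f \<in> ext_cocycles Q N i d" for f
      using ext_chain_endomorphism[OF Q chain_map_compose[OF \<phi> \<psi>] that] by (simp add: comp_assoc)
    show "f - (f \<circ> \<phi> i \<circ> \<psi> i) \<in> ext_coboundaries P N i d" if "f \<in> ext_cocycles P N i d" for f
      using ext_chain_endomorphism[OF P chain_map_compose[OF \<psi> \<phi>] that] by (simp add: comp_assoc)
  qed (use N ext_coboundaries_subset_cocycles[OF N P] ext_coboundaries_subset_cocycles[OF N Q] in
      \<open>auto intro: is_add_subgroup_ext_cocycles is_add_subgroup_ext_coboundaries
        ext_cocycles_pullback[OF \<phi>] ext_cocycles_pullback[OF \<psi>]
        ext_coboundaries_pullback[OF \<phi>] ext_coboundaries_pullback[OF \<psi>] simp: plus_compose\<close>)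
qed

lemma nonzero_Ext_iff:
  assumes M: "graded_module M" and N: "graded_module N" and P: "graded_free_resolution M P"
  shows "nonzero_group (Ext M N i d) \<longleftrightarrow> \<not> ext_cocycles P N i d \<subseteq> ext_coboundaries P N i d"
  using Ext_iso[OF M N P] unfolding Ext_def
  by (rule nonzero_quotient_iso_iff)
    (intro is_add_subgroup_ext_cocycles is_add_subgroup_ext_coboundaries
      ext_coboundaries_subset_cocycles[OF N P]
      ext_coboundaries_subset_cocycles[OF N graded_free_resolution_resolution_of[OF P]] N)+

section \<open>Independence of Tor from the resolution\<close>

lemma tensor_map_0 [simp]: "tensor_map f 0 = 0"
  and tensor_map_minus: "tensor_map f (z - w) = tensor_map f z - tensor_map f w"
  and tensor_map_plus: "tensor_map f (z + w) = tensor_map f z + tensor_map f w"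
  and tensor_map_frag_of [simp]: "tensor_map f (frag_of (a, n)) = frag_of (f a, n)"
  by (simp_all add: tensor_map_def frag_extend_diff frag_extend_add)

lemma tensor_map_compose: "tensor_map g (tensor_map f z) = tensor_map (g \<circ> f) z"
  using subset_UNIV by (induction z rule: frag_induction) (auto simp: tensor_map_minus)

lemma is_add_subgroup_tensor_rel: "is_add_subgroup (tensor_rel A N)"
  by (simp add: is_add_subgroup_def tensor_rel_def group_closure.diff)

lemma is_add_subgroup_tensor_comp: "is_add_subgroup (tensor_comp A N d)"
  by (simp add: is_add_subgroup_def tensor_comp_def group_closure.diff)

lemma tensor_rel_zero [simp]: "0 \<in> tensor_rel A N"
  and tensor_rel_minus: "z \<in> tensor_rel A N \<Longrightarrow> w \<in> tensor_rel A N \<Longrightarrow> z - w \<in> tensor_rel A N"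
  and tensor_comp_zero [simp]: "0 \<in> tensor_comp A N d"
  and tensor_comp_minus: "z \<in> tensor_comp A N d \<Longrightarrow> w \<in> tensor_comp A N d \<Longrightarrow> z - w \<in> tensor_comp A N d"
  using is_add_subgroup_tensor_rel is_add_subgroup_tensor_comp unfolding is_add_subgroup_def
  by blast+

lemmas tensor_rel_plus = is_add_subgroup_plus[OF is_add_subgroup_tensor_rel]
  and tensor_comp_plus = is_add_subgroup_plus[OF is_add_subgroup_tensor_comp]

lemma tensor_rel_add_left: "a \<in> carr A \<Longrightarrow> a' \<in> carr A \<Longrightarrow> n \<in> carr N \<Longrightarrow>
    frag_of (a + a', n) - frag_of (a, n) - frag_of (a', n) \<in> tensor_rel A N"
  unfolding tensor_rel_def by (rule group_closure.base) blast

lemma tensor_rel_add_right: "a \<in> carr A \<Longrightarrow> n \<in> carr N \<Longrightarrow> n' \<in> carr N \<Longrightarrow>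
    frag_of (a, n + n') - frag_of (a, n) - frag_of (a, n') \<in> tensor_rel A N"
  unfolding tensor_rel_def by (rule group_closure.base) blast

lemma tensor_rel_smult: "a \<in> carr A \<Longrightarrow> n \<in> carr N \<Longrightarrow>
    frag_of (smult A p a, n) - frag_of (a, smult N p n) \<in> tensor_rel A N"
  unfolding tensor_rel_def by (rule group_closure.base) blast

lemma tensor_rel_zero_left:
  assumes "graded_module A" "n \<in> carr N" shows "frag_of (0, n) \<in> tensor_rel A N"
  using tensor_rel_add_left[OF carr_zero[OF assms(1)] carr_zero[OF assms(1)] assms(2)]
    is_add_subgroup_uminus[OF is_add_subgroup_tensor_rel] by fastforce

lemma tensor_rel_zero_right:
  assumes "graded_module N" "a \<in> carr A" shows "frag_of (a, 0) \<in> tensor_rel A N"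
  using tensor_rel_add_right[OF assms(2) carr_zero[OF assms(1)] carr_zero[OF assms(1)]]
    is_add_subgroup_uminus[OF is_add_subgroup_tensor_rel] by fastforce

lemma tensor_rel_induct [consumes 1, case_names zero add_left add_right smult minus]:
  assumes "z \<in> tensor_rel A N" and "Q 0"
    and "\<And>a a' n. a \<in> carr A \<Longrightarrow> a' \<in> carr A \<Longrightarrow> n \<in> carr N \<Longrightarrow>
      Q (frag_of (a + a', n) - frag_of (a, n) - frag_of (a', n))"
    and "\<And>a n n'. a \<in> carr A \<Longrightarrow> n \<in> carr N \<Longrightarrow> n' \<in> carr N \<Longrightarrow>
      Q (frag_of (a, n + n') - frag_of (a, n) - frag_of (a, n'))"
    and "\<And>p a n. a \<in> carr A \<Longrightarrow> n \<in> carr N \<Longrightarrow>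
      Q (frag_of (smult A p a, n) - frag_of (a, smult N p n))"
    and "\<And>z w. Q z \<Longrightarrow> Q w \<Longrightarrow> Q (z - w)"
  shows "Q z"
  using assms(1) unfolding tensor_rel_def
proof induction
  case (base s)
  then show ?case using assms(2-5) by blast
next
  case (diff s t)
  then show ?case using assms(6) by blast
qed

lemma tensor_comp_frag_of:
  "a \<in> comp A i \<Longrightarrow> n \<in> comp N j \<Longrightarrow> frag_of (a, n) \<in> tensor_comp A N (i + j)"
  unfolding tensor_comp_def by (rule group_closure.base) blast

lemma tensor_comp_induct [consumes 1, case_names zero frag_of minus]:
  assumes "z \<in> tensor_comp A N d" and "Q 0"
    and "\<And>a n i j. i + j = d \<Longrightarrow> a \<in> comp A i \<Longrightarrow> n \<in> comp N j \<Longrightarrow> Q (frag_of (a, n))"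
    and "\<And>z w. Q z \<Longrightarrow> Q w \<Longrightarrow> Q (z - w)"
  shows "Q z"
  using assms(1) unfolding tensor_comp_def
proof induction
  case (base s)
  then show ?case using assms(2,3) by blast
next
  case (diff s t)
  then show ?case using assms(4) by blast
qed

lemma tensor_map_rel:
  assumes f: "f \<in> grhom A B d" and z: "z \<in> tensor_rel A N"
  shows "tensor_map f z \<in> tensor_rel B N"
  using z
proof (induction rule: tensor_rel_induct)
  case (add_left a a' n)
  then show ?case
    using tensor_rel_add_left[OF grhom_carr[OF f] grhom_carr[OF f], of a a' n N]
    by (simp add: tensor_map_minus grhom_add[OF f])
next
  case (add_right a n n')
  then show ?case using tensor_rel_add_right[OF grhom_carr[OF f], of a n N n']
    by (simp add: tensor_map_minus)
next
  case (smult p a n)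
  then show ?case using tensor_rel_smult[OF grhom_carr[OF f], of a n N p]
    by (simp add: tensor_map_minus grhom_smult[OF f])
qed (simp_all add: tensor_map_minus tensor_rel_minus)

lemma tensor_map_comp:
  assumes f: "f \<in> grhom A B e" and z: "z \<in> tensor_comp A N d"
  shows "tensor_map f z \<in> tensor_comp B N (d + e)"
  using z
proof (induction rule: tensor_comp_induct)
  case (frag_of a n i j)
  then have "frag_of (f a, n) \<in> tensor_comp B N ((i + e) + j)"
    by (intro tensor_comp_frag_of grhom_comp[OF f])
  then show ?case using frag_of(1) by (simp add: algebra_simps)
qed (simp_all add: tensor_map_minus tensor_comp_minus)

lemmas tensor_map_comp_0 = tensor_map_comp[where e = 0, simplified]

lemma tensor_map_id:
  assumes "graded_module A" "z \<in> tensor_comp A N d"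
  shows "tensor_map (grhom_id A) z = z"
  using assms(2)
  by (induction rule: tensor_comp_induct)
    (simp_all add: tensor_map_minus grhom_id_def comp_subset_carr[OF assms(1)])

lemma tensor_map_zero_rel:
  assumes B: "graded_module B" and N: "graded_module N" and z: "z \<in> tensor_comp A N d"
  shows "tensor_map 0 z \<in> tensor_rel B N"
  using z
  by (induction rule: tensor_comp_induct)
    (simp_all add: tensor_map_minus tensor_rel_minus tensor_rel_zero_left[OF B]
      comp_subset_carr[OF N])

lemma tensor_map_add_rel:
  assumes A: "graded_module A" and N: "graded_module N"
    and f: "f \<in> grhom A B e" and g: "g \<in> grhom A B e" and z: "z \<in> tensor_comp A N d"
  shows "tensor_map (f + g) z - tensor_map f z - tensor_map g z \<in> tensor_rel B N"
  using z
proof (induction rule: tensor_comp_induct)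
  case (frag_of a n i j)
  then show ?case
    using tensor_rel_add_left[OF grhom_carr[OF f] grhom_carr[OF g], of a a n N]
      comp_subset_carr[OF A, of a] comp_subset_carr[OF N, of n] by simp
next
  case (minus z w)
  then show ?case using tensor_rel_minus[OF minus] by (simp add: tensor_map_minus algebra_simps)
qed simp

lemma tor_boundariesI:
  assumes "z \<in> tensor_comp (term_of P i) N d" "w \<in> tensor_comp (term_of P (Suc i)) N d"
    "z - tensor_map (diff P i) w \<in> tensor_rel (term_of P i) N"
  shows "z \<in> tor_boundaries P N i d"
  using assms unfolding tor_boundaries_def by blast

lemma tor_cycles_iff:
  "z \<in> tor_cycles P N i d \<longleftrightarrow> z \<in> tensor_comp (term_of P i) N d \<and>
    (\<forall>j. i = Suc j \<longrightarrow> tensor_map (diff P j) z \<in> tensor_rel (term_of P j) N)"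
  by (simp add: tor_cycles_def split: nat.split)

lemma is_add_subgroup_tor_cycles: "is_add_subgroup (tor_cycles P N i d)"
  by (simp add: is_add_subgroup_def tor_cycles_iff tensor_comp_minus tensor_map_minus
      tensor_rel_minus)

lemma is_add_subgroup_tor_boundaries: "is_add_subgroup (tor_boundaries P N i d)"
  unfolding is_add_subgroup_def
proof (intro conjI ballI)
  show "0 \<in> tor_boundaries P N i d" by (rule tor_boundariesI[of _ _ _ _ _ 0]) simp_all
  fix a b assume "a \<in> tor_boundaries P N i d" "b \<in> tor_boundaries P N i d"
  then obtain u v where a: "a \<in> tensor_comp (term_of P i) N d"
      "u \<in> tensor_comp (term_of P (Suc i)) N d"
      "a - tensor_map (diff P i) u \<in> tensor_rel (term_of P i) N"
    and b: "b \<in> tensor_comp (term_of P i) N d"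
      "v \<in> tensor_comp (term_of P (Suc i)) N d"
      "b - tensor_map (diff P i) v \<in> tensor_rel (term_of P i) N"
    unfolding tor_boundaries_def by blast
  have "a - b - tensor_map (diff P i) (u - v) \<in> tensor_rel (term_of P i) N"
    using tensor_rel_minus[OF a(3) b(3)] by (simp add: tensor_map_minus algebra_simps)
  with tensor_comp_minus[OF a(1) b(1)] tensor_comp_minus[OF a(2) b(2)]
  show "a - b \<in> tor_boundaries P N i d" by (rule tor_boundariesI)
qed

lemma tor_boundaries_subset_cycles:
  assumes N: "graded_module N" and P: "graded_free_resolution M P"
  shows "tor_boundaries P N i d \<subseteq> tor_cycles P N i d"
proof
  fix z assume "z \<in> tor_boundaries P N i d"
  then obtain w where z: "z \<in> tensor_comp (term_of P i) N d"
    and w: "w \<in> tensor_comp (term_of P (Suc i)) N d"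
    and zw: "z - tensor_map (diff P i) w \<in> tensor_rel (term_of P i) N"
    unfolding tor_boundaries_def by blast
  have "tensor_map (diff P j) z \<in> tensor_rel (term_of P j) N" if i: "i = Suc j" for j
  proof -
    have "tensor_map (diff P j) (tensor_map (diff P i) w) \<in> tensor_rel (term_of P j) N"
      using tensor_map_zero_rel[OF graded_module_free N w]
      by (simp add: tensor_map_compose i diff_compose_diff[OF P])
    moreover have "tensor_map (diff P j) (z - tensor_map (diff P i) w) \<in> tensor_rel (term_of P j) N"
      using tensor_map_rel[OF diff_grhom[OF P]] zw i by blast
    ultimately show ?thesis using tensor_rel_plus by (fastforce simp: tensor_map_minus)
  qed
  with z show "z \<in> tor_cycles P N i d" by (simp add: tor_cycles_iff)
qed

lemma tor_cycles_image:
  assumes \<phi>: "chain_map Q P \<phi>" and z: "z \<in> tor_cycles Q N i d"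
  shows "tensor_map (\<phi> i) z \<in> tor_cycles P N i d"
proof -
  have "tensor_map (diff P j) (tensor_map (\<phi> i) z) \<in> tensor_rel (term_of P j) N"
    if i: "i = Suc j" for j
  proof -
    have "tensor_map (diff P j) (tensor_map (\<phi> i) z) = tensor_map (\<phi> j) (tensor_map (diff Q j) z)"
      by (simp add: tensor_map_compose i chain_map_diff[OF \<phi>])
    then show ?thesis
      using z i by (simp add: tor_cycles_iff tensor_map_rel[OF chain_map_grhom[OF \<phi>]])
  qed
  then show ?thesis
    using z by (simp add: tor_cycles_iff tensor_map_comp_0[OF chain_map_grhom[OF \<phi>]])
qed

lemma tor_boundaries_image:
  assumes \<phi>: "chain_map Q P \<phi>" and z: "z \<in> tor_boundaries Q N i d"
  shows "tensor_map (\<phi> i) z \<in> tor_boundaries P N i d"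
proof -
  obtain w where z: "z \<in> tensor_comp (term_of Q i) N d"
    and w: "w \<in> tensor_comp (term_of Q (Suc i)) N d"
    and zw: "z - tensor_map (diff Q i) w \<in> tensor_rel (term_of Q i) N"
    using z unfolding tor_boundaries_def by blast
  have "tensor_map (\<phi> i) z - tensor_map (diff P i) (tensor_map (\<phi> (Suc i)) w)
      = tensor_map (\<phi> i) (z - tensor_map (diff Q i) w)"
    by (simp add: tensor_map_minus tensor_map_compose chain_map_diff[OF \<phi>])
  also have "\<dots> \<in> tensor_rel (term_of P i) N"
    by (rule tensor_map_rel[OF chain_map_grhom[OF \<phi>] zw])
  finally show ?thesis
    by (rule tor_boundariesI[OF tensor_map_comp_0[OF chain_map_grhom[OF \<phi>] z]
          tensor_map_comp_0[OF chain_map_grhom[OF \<phi>] w]])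
qed

lemma tensor_map_homotopy_tail:
  assumes N: "graded_module N" and h: "chain_homotopy Q P \<phi> \<theta> h" and z: "z \<in> tor_cycles Q N i d"
  shows "tensor_map (homotopy_tail Q h i) z \<in> tensor_rel (term_of P i) N"
proof (cases i)
  case 0
  then show ?thesis
    using tensor_map_zero_rel[OF graded_module_free N] z
    by (auto simp: homotopy_tail_def tor_cycles_iff)
next
  case (Suc j)
  then have "tensor_map (h j) (tensor_map (diff Q j) z) \<in> tensor_rel (term_of P i) N"
    using z by (simp add: tor_cycles_iff tensor_map_rel[OF chain_homotopy_grhom[OF h]])
  then show ?thesis using Suc by (simp add: homotopy_tail_def tensor_map_compose)
qed

lemma tor_homotopic:
  assumes N: "graded_module N"
    and Q: "graded_free_resolution M Q" and P: "graded_free_resolution M P"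
    and \<phi>: "chain_map Q P \<phi>" and \<theta>: "chain_map Q P \<theta>"
    and z: "z \<in> tor_cycles Q N i d"
  shows "tensor_map (\<phi> i) z - tensor_map (\<theta> i) z \<in> tor_boundaries P N i d"
proof -
  obtain h where h: "chain_homotopy Q P \<phi> \<theta> h" using chain_homotopy_exists[OF Q P \<phi> \<theta>] ..
  note \<phi>_grhom = chain_map_grhom[OF \<phi>, of i] and \<theta>_grhom = chain_map_grhom[OF \<theta>, of i]
    and h_grhom = chain_homotopy_grhom[OF h, of i]
    and tail_grhom = homotopy_tail_grhom[OF Q h, of i]
  note dh_grhom = grhom_precompose[OF graded_module_free h_grhom diff_grhom[OF P]]
  let ?R = "tensor_rel (term_of P i) N" and ?\<delta> = "\<phi> i - \<theta> i" and ?t = "homotopy_tail Q h i"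
  have zc: "z \<in> tensor_comp (term_of Q i) N d" using z by (simp add: tor_cycles_iff)
  have "tensor_map (?\<delta> + \<theta> i) z - tensor_map ?\<delta> z - tensor_map (\<theta> i) z \<in> ?R"
    by (rule tensor_map_add_rel[OF graded_module_free N
          grhom_minus[OF graded_module_free \<phi>_grhom \<theta>_grhom] \<theta>_grhom zc])
  moreover have "tensor_map ?\<delta> z - tensor_map (diff P i \<circ> h i) z - tensor_map ?t z \<in> ?R"
    unfolding chain_homotopy_diff[OF h]
    by (rule tensor_map_add_rel[OF graded_module_free N dh_grhom tail_grhom zc])
  moreover have "tensor_map ?t z \<in> ?R"
    by (rule tensor_map_homotopy_tail[OF N h z])
  ultimately have "(tensor_map (?\<delta> + \<theta> i) z - tensor_map ?\<delta> z - tensor_map (\<theta> i) z) +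
      (tensor_map ?\<delta> z - tensor_map (diff P i \<circ> h i) z - tensor_map ?t z) + tensor_map ?t z \<in> ?R"
    by (intro tensor_rel_plus)
  then have "tensor_map (\<phi> i) z - tensor_map (\<theta> i) z -
      tensor_map (diff P i) (tensor_map (h i) z) \<in> ?R"
    by (simp add: tensor_map_compose algebra_simps)
  then show ?thesis
    by (rule tor_boundariesI[OF tensor_comp_minus[OF tensor_map_comp_0[OF \<phi>_grhom zc]
            tensor_map_comp_0[OF \<theta>_grhom zc]] tensor_map_comp_0[OF h_grhom zc]])
qed

lemma tor_chain_endomorphism:
  assumes N: "graded_module N" and Q: "graded_free_resolution M Q" and \<theta>: "chain_map Q Q \<theta>"
    and z: "z \<in> tor_cycles Q N i d"
  shows "z - tensor_map (\<theta> i) z \<in> tor_boundaries Q N i d"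
proof -
  have "z \<in> tensor_comp (term_of Q i) N d" using z by (simp add: tor_cycles_iff)
  then have "tensor_map (grhom_id (term_of Q i)) z = z"
    by (rule tensor_map_id[OF graded_module_free])
  then show ?thesis using tor_homotopic[OF N Q Q chain_map_id[OF Q] \<theta> z] by simp
qed

theorem Tor_iso:
  assumes M: "graded_module M" and N: "graded_module N" and P: "graded_free_resolution M P"
  shows "Tor M N i d \<cong> additive_group (tor_cycles P N i d) Mod tor_boundaries P N i d"
proof -
  define Q where "Q = resolution_of M"
  have Q: "graded_free_resolution M Q"
    unfolding Q_def by (rule graded_free_resolution_resolution_of[OF P])
  obtain \<phi> where \<phi>: "chain_map Q P \<phi>" using chain_map_exists[OF M Q P] ..
  obtain \<psi> where \<psi>: "chain_map P Q \<psi>" using chain_map_exists[OF M P Q] ..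
  show ?thesis
    unfolding Tor_def Q_def[symmetric]
  proof (rule quotient_iso[where \<phi> = "tensor_map (\<phi> i)" and \<psi> = "tensor_map (\<psi> i)"])
    show "z - tensor_map (\<psi> i) (tensor_map (\<phi> i) z) \<in> tor_boundaries Q N i d"
      if "z \<in> tor_cycles Q N i d" for z
      using tor_chain_endomorphism[OF N Q chain_map_compose[OF \<phi> \<psi>] that]
      by (simp add: tensor_map_compose)
    show "z - tensor_map (\<phi> i) (tensor_map (\<psi> i) z) \<in> tor_boundaries P N i d"
      if "z \<in> tor_cycles P N i d" for z
      using tor_chain_endomorphism[OF N P chain_map_compose[OF \<psi> \<phi>] that]
      by (simp add: tensor_map_compose)
  qed (use tor_boundaries_subset_cycles[OF N P] tor_boundaries_subset_cycles[OF N Q] in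
      \<open>auto intro: is_add_subgroup_tor_cycles is_add_subgroup_tor_boundaries
        tor_cycles_image[OF \<phi>] tor_cycles_image[OF \<psi>]
        tor_boundaries_image[OF \<phi>] tor_boundaries_image[OF \<psi>] simp: tensor_map_plus\<close>)
qed

lemma nonzero_Tor_iff:
  assumes M: "graded_module M" and N: "graded_module N" and P: "graded_free_resolution M P"
  shows "nonzero_group (Tor M N i d) \<longleftrightarrow> \<not> tor_cycles P N i d \<subseteq> tor_boundaries P N i d"
  using Tor_iso[OF M N P] unfolding Tor_def
  by (rule nonzero_quotient_iso_iff)
    (intro is_add_subgroup_tor_cycles is_add_subgroup_tor_boundaries
      tor_boundaries_subset_cycles[OF N P]
      tor_boundaries_subset_cycles[OF N graded_free_resolution_resolution_of[OF P]])+

section \<open>Tor and Ext of a minimal resolution\<close>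

definition irrelevant_part ::
    "(('x::finite, 'k::field) mpoly, 'm::ab_group_add) grmod \<Rightarrow> 'm set" where
  "irrelevant_part A = Modules.module.span (smult A)
     {smult A p v | p v. p \<in> irrelevant_ideal \<and> v \<in> carr A}"

lemma minimal_resolutionD: "minimal_graded_free_resolution M F \<Longrightarrow> graded_free_resolution M F"
  by (simp add: minimal_graded_free_resolution_def)

lemma minimal_diff_irrelevant:
  "minimal_graded_free_resolution M F \<Longrightarrow> v \<in> carr (term_of F (Suc i)) \<Longrightarrow>
    diff F i v \<in> irrelevant_part (term_of F i)"
  unfolding minimal_graded_free_resolution_def irrelevant_part_def by blast

lemma irrelevant_part_free_iff:
  assumes v: "v \<in> carr (free_grmod ds)"
  shows "v \<in> irrelevant_part (free_grmod ds) \<longleftrightarrow> (\<forall>j. const_term (v j) = 0)"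
proof
  interpret free: Modules.module "smult (free_grmod ds)" by (rule module_free)
  show "\<forall>j. const_term (v j) = 0" if "v \<in> irrelevant_part (free_grmod ds)"
    using that unfolding irrelevant_part_def
  proof (induction rule: free.span_induct_alt)
    case (step c x y)
    then obtain p u where "x = smult (free_grmod ds) p u" "p \<in> irrelevant_ideal" by blast
    then have "const_term (x j) = 0" for j
      by (simp add: free_grmod_def const_term_mult flip: lookup_0_eq_0_iff)
    then show ?case using step by (simp add: free_grmod_def lookup_add const_term_mult)
  qed simp
  assume "\<forall>j. const_term (v j) = 0"
  then have "v j \<in> irrelevant_ideal" for j by (simp flip: lookup_0_eq_0_iff)
  then have "(\<Sum>j<length ds. smult (free_grmod ds) (v j) (basis_vec j))
      \<in> irrelevant_part (free_grmod ds)"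
    unfolding irrelevant_part_def
    using basis_vec_carr[of _ ds] by (intro free.span_sum free.span_base) blast
  then show "v \<in> irrelevant_part (free_grmod ds)" by (simp add: free_expansion[OF v])
qed

lemma minimal_diff_const_term:
  assumes F: "minimal_graded_free_resolution M F" and v: "v \<in> carr (term_of F (Suc i))"
  shows "const_term (diff F i v j) = 0"
  using minimal_diff_irrelevant[OF F v] grhom_carr[OF diff_grhom[OF minimal_resolutionD[OF F]] v]
  by (simp add: irrelevant_part_free_iff)

lemma tensor_rel_irrelevant_part:
  assumes A: "graded_module A" and v: "v \<in> irrelevant_part A"
  shows "frag_of (v, c) \<in> tensor_rel A residue_grmod"
proof -
  interpret A: Modules.module "smult A" by (rule graded_module_module[OF A])
  have c: "c \<in> carr residue_grmod" by (simp add: residue_grmod_def)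
  from v have "v \<in> carr A \<and> frag_of (v, c) \<in> tensor_rel A residue_grmod"
    unfolding irrelevant_part_def
  proof (induction rule: A.span_induct_alt)
    case base
    show ?case by (simp add: carr_zero[OF A] tensor_rel_zero_left[OF A c])
  next
    case (step q x y)
    then obtain p u where x: "x = smult A p u" "p \<in> irrelevant_ideal" "u \<in> carr A" by blast
    let ?t = "smult A (q * p) u"
    have t: "?t \<in> carr A" by (rule carr_smult[OF A x(3)])
    have "smult residue_grmod (q * p) c = 0"
      using x(2) by (simp add: residue_grmod_def const_term_mult flip: lookup_0_eq_0_iff)
    then have "frag_of (?t, c) \<in> tensor_rel A residue_grmod"
      using tensor_rel_plus[OF tensor_rel_smult[OF x(3) c, of "q * p"]
          tensor_rel_zero_right[OF graded_module_residue_grmod x(3)]] by simp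
    then have "frag_of (?t + y, c) \<in> tensor_rel A residue_grmod"
      using tensor_rel_plus[OF tensor_rel_plus[OF tensor_rel_add_left[OF t _ c, of y]]] step
      by fastforce
    then show ?case using step t by (simp add: x(1) carr_add[OF A])
  qed
  then show ?thesis ..
qed

lemma tensor_map_minimal_diff:
  assumes F: "minimal_graded_free_resolution M F"
    and w: "w \<in> tensor_comp (term_of F (Suc i)) residue_grmod d"
  shows "tensor_map (diff F i) w \<in> tensor_rel (term_of F i) residue_grmod"
  using w
  by (induction rule: tensor_comp_induct)
    (simp_all add: tensor_map_minus tensor_rel_minus tensor_rel_irrelevant_part
      minimal_diff_irrelevant[OF F] comp_subset_carr[OF graded_module_free])

lemma minimal_tor_cycles:
  assumes "minimal_graded_free_resolution M F"
  shows "tor_cycles F residue_grmod i d = tensor_comp (term_of F i) residue_grmod d"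
  using tensor_map_minimal_diff[OF assms] by (auto simp: tor_cycles_iff)

lemma minimal_tor_boundaries:
  assumes F: "minimal_graded_free_resolution M F"
  shows "tor_boundaries F residue_grmod i d =
    tensor_comp (term_of F i) residue_grmod d \<inter> tensor_rel (term_of F i) residue_grmod"
proof -
  have "z - tensor_map (diff F i) w \<in> tensor_rel (term_of F i) residue_grmod \<longleftrightarrow>
      z \<in> tensor_rel (term_of F i) residue_grmod"
    if "w \<in> tensor_comp (term_of F (Suc i)) residue_grmod d" for z w
    using tensor_rel_plus[OF _ tensor_map_minimal_diff[OF F that]]
      tensor_rel_minus[OF _ tensor_map_minimal_diff[OF F that]] by fastforce
  then show ?thesis
    unfolding tor_boundaries_def using tensor_comp_zero by blast
qed

definition frag_eval :: "('a \<Rightarrow> 'b::ring_1) \<Rightarrow> ('a \<Rightarrow>\<^sub>0 int) \<Rightarrow> 'b" where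
  "frag_eval b z = (\<Sum>x\<in>Poly_Mapping.keys z. of_int (Poly_Mapping.lookup z x) * b x)"

lemma frag_eval_0 [simp]: "frag_eval b 0 = 0"
  and frag_eval_frag_of [simp]: "frag_eval b (frag_of x) = b x"
  by (simp_all add: frag_eval_def)

lemma frag_eval_minus: "frag_eval b (z - w) = frag_eval b z - frag_eval b w"
proof -
  let ?S = "Poly_Mapping.keys z \<union> Poly_Mapping.keys w"
  have superset: "frag_eval b u = (\<Sum>x\<in>?S. of_int (Poly_Mapping.lookup u x) * b x)"
    if "Poly_Mapping.keys u \<subseteq> ?S" for u
    unfolding frag_eval_def using that by (intro sum.mono_neutral_left) (auto simp: in_keys_iff)
  have "Poly_Mapping.keys (z - w) \<subseteq> ?S" by (auto simp: in_keys_iff lookup_minus)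
  then show ?thesis
    by (simp add: superset lookup_minus left_diff_distrib sum_subtractf)
qed

lemma frag_eval_balanced:
  assumes "\<And>a a' n. a \<in> carr A \<Longrightarrow> a' \<in> carr A \<Longrightarrow> n \<in> carr N \<Longrightarrow> b (a + a', n) = b (a, n) + b (a', n)"
    and "\<And>a n n'. a \<in> carr A \<Longrightarrow> n \<in> carr N \<Longrightarrow> n' \<in> carr N \<Longrightarrow> b (a, n + n') = b (a, n) + b (a, n')"
    and "\<And>p a n. a \<in> carr A \<Longrightarrow> n \<in> carr N \<Longrightarrow> b (smult A p a, n) = b (a, smult N p n)"
    and "z \<in> tensor_rel A N"
  shows "frag_eval b z = 0"
  using assms(4) by (induction rule: tensor_rel_induct) (simp_all add: frag_eval_minus assms(1-3))

lemma basis_vec_tensor_nonzero: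
  "frag_of (basis_vec j, 1) \<notin>
    tensor_rel (free_grmod ds :: (('x::finite, 'k::field) mpoly, _) grmod) residue_grmod"
proof
  define b :: "(nat \<Rightarrow> ('x, 'k) mpoly) \<times> 'k \<Rightarrow> 'k" where "b = (\<lambda>(v, c). const_term (v j) * c)"
  assume "frag_of (basis_vec j, 1) \<in>
    tensor_rel (free_grmod ds :: (('x::finite, 'k::field) mpoly, _) grmod) residue_grmod"
  then have "frag_eval b (frag_of (basis_vec j, 1)) = 0"
    by (rule frag_eval_balanced[rotated 3])
      (simp_all add: b_def free_grmod_def residue_grmod_def lookup_add const_term_mult
        algebra_simps)
  then show False by (simp add: b_def basis_vec_def)
qed

lemma free_comp_subset_irrelevant_part:
  assumes a: "a \<in> comp (free_grmod ds) d" and d: "d \<notin> set ds"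
  shows "a \<in> irrelevant_part (free_grmod ds)"
proof -
  have "const_term (a j) = 0" for j
  proof (cases "j < length ds")
    case True
    then have "a j \<in> mpoly_comp (d - ds ! j)" "d - ds ! j \<noteq> 0"
      using a d by (auto simp: free_grmod_def)
    then show ?thesis by (rule const_term_mpoly_comp)
  next
    case False
    then show ?thesis using a by (simp add: free_grmod_def)
  qed
  then show ?thesis
    by (simp add: irrelevant_part_free_iff comp_subset_carr[OF graded_module_free a])
qed

lemma free_tensor_residue_zero_iff:
  "tensor_comp (free_grmod ds) residue_grmod d \<subseteq> tensor_rel (free_grmod ds) residue_grmod \<longleftrightarrow>
    d \<notin> set ds"
  (is "?C \<subseteq> ?R \<longleftrightarrow> _")
proof
  assume zero: "?C \<subseteq> ?R"
  show "d \<notin> set ds"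
  proof
    assume "d \<in> set ds"
    then obtain j where "j < length ds" "ds ! j = d" by (auto simp: in_set_conv_nth)
    then have "frag_of (basis_vec j, 1) \<in> tensor_comp (free_grmod ds) residue_grmod (d + 0)"
      using basis_vec_comp[of j ds] by (intro tensor_comp_frag_of) (simp_all add: residue_grmod_def)
    then show False using zero basis_vec_tensor_nonzero by auto
  qed
next
  assume d: "d \<notin> set ds"
  have "z \<in> ?R" if "z \<in> ?C" for z
    using that
  proof (induction rule: tensor_comp_induct)
    case (frag_of a c e e')
    show ?case
    proof (cases "c = 0")
      case True
      then show ?thesis
        using comp_subset_carr[OF graded_module_free frag_of(2)]
        by (simp add: tensor_rel_zero_right)
    next
      case False
      then have "e = d" using frag_of by (auto simp: residue_grmod_def split: if_splits)
      then show ?thesis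
        using frag_of(2) d
        by (simp add: tensor_rel_irrelevant_part free_comp_subset_irrelevant_part)
    qed
  qed (simp_all add: tensor_rel_minus)
  then show "?C \<subseteq> ?R" by blast
qed

lemma nonzero_Tor_residue_iff:
  assumes M: "graded_module M" and F: "minimal_graded_free_resolution M F"
  shows "nonzero_group (Tor M residue_grmod i d) \<longleftrightarrow> d \<in> set (gens F i)"
  by (simp add: nonzero_Tor_iff[OF M graded_module_residue_grmod minimal_resolutionD[OF F]]
      minimal_tor_cycles[OF F] minimal_tor_boundaries[OF F] free_tensor_residue_zero_iff)

lemma grhom_free_ring_eq_0:
  assumes f: "f \<in> grhom (free_grmod ds) ring_grmod d" and d: "\<And>e. e \<in> set ds \<Longrightarrow> e + d < 0"
  shows "f = 0"
proof (rule grhom_free_eqI[OF f zero_in_grhom[OF graded_module_ring_grmod]])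
  fix j assume j: "j < length ds"
  have "f (basis_vec j) \<in> mpoly_comp (ds ! j + d)"
    using grhom_comp[OF f basis_vec_comp[OF j]] by (simp add: ring_grmod_def)
  then show "f (basis_vec j) = 0 (basis_vec j)"
    using d[OF nth_mem[OF j]] by (simp add: mpoly_comp_negative)
qed

lemma nonzero_Ext_ring_degree_bound:
  assumes M: "graded_module M" and P: "graded_free_resolution M P"
    and nonzero: "nonzero_group (Ext M ring_grmod i d)"
  shows "\<exists>e\<in>set (gens P i). - d \<le> e"
proof (rule ccontr)
  assume "\<not> ?thesis"
  then have "e + d < 0" if "e \<in> set (gens P i)" for e using that by force
  then have "ext_cocycles P ring_grmod i d \<subseteq> {0}"
    using grhom_free_ring_eq_0 by (auto simp: ext_cocycles_def)
  also have "\<dots> \<subseteq> ext_coboundaries P ring_grmod i d"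
    by (simp add: is_add_subgroup_zero is_add_subgroup_ext_coboundaries)
  finally show False using nonzero nonzero_Ext_iff[OF M graded_module_ring_grmod P] by blast
qed

definition coordinate ::
    "int list \<Rightarrow> nat \<Rightarrow> (nat \<Rightarrow> ('x::finite, 'k::field) mpoly) \<Rightarrow> ('x, 'k) mpoly" where
  "coordinate ds j = free_extension ring_grmod ds (basis_vec j)"

lemma coordinate_in_grhom:
  "coordinate ds j \<in> grhom (free_grmod ds) ring_grmod (- (ds ! j))"
  unfolding coordinate_def
  by (rule free_extension_in_grhom[OF graded_module_ring_grmod])
    (auto simp: ring_grmod_def basis_vec_def one_in_mpoly_comp)

lemma coordinate_eq:
  assumes "v \<in> carr (free_grmod ds)" "j < length ds"
  shows "coordinate ds j v = v j"
proof -
  have "coordinate ds j v = (\<Sum>l<length ds. v l * basis_vec j l)"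
    using assms(1) by (simp add: coordinate_def free_extension_def) (simp add: ring_grmod_def)
  also have "\<dots> = (\<Sum>l<length ds. if l = j then v l else 0)"
    by (rule sum.cong) (simp_all add: basis_vec_def)
  finally show ?thesis using assms(2) by simp
qed

lemma minimal_coordinate_cocycle:
  assumes F: "minimal_graded_free_resolution M F" and j: "j < length (gens F i)"
    and le: "\<And>e. e \<in> set (gens F (Suc i)) \<Longrightarrow> e \<le> gens F i ! j"
  shows "coordinate (gens F i) j \<in> ext_cocycles F ring_grmod i (- (gens F i ! j))"
proof -
  let ?c = "coordinate (gens F i) j" and ?b = "gens F i ! j"
  have cd: "?c \<circ> diff F i \<in> grhom (term_of F (Suc i)) ring_grmod (- ?b)"
    by (rule grhom_precompose[OF graded_module_free diff_grhom[OF minimal_resolutionD[OF F]]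
          coordinate_in_grhom])
  have "?c \<circ> diff F i = 0"
  proof (rule grhom_free_eqI[OF cd zero_in_grhom[OF graded_module_ring_grmod]])
    fix l assume l: "l < length (gens F (Suc i))"
    let ?p = "(?c \<circ> diff F i) (basis_vec l)"
    have p: "?p \<in> mpoly_comp (gens F (Suc i) ! l - ?b)"
      using grhom_comp[OF cd basis_vec_comp[OF l]] by (simp add: ring_grmod_def)
    have "?p = 0"
    proof (cases "gens F (Suc i) ! l = ?b")
      case True
      moreover have "const_term ?p = 0"
        using minimal_diff_const_term[OF F basis_vec_carr[OF l]]
          grhom_carr[OF diff_grhom[OF minimal_resolutionD[OF F]] basis_vec_carr[OF l]]
        by (simp add: coordinate_eq j)
      ultimately show ?thesis using p by (simp add: mpoly_comp_0_eq_0)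
    next
      case False
      then show ?thesis using mpoly_comp_negative[OF p] le[OF nth_mem[OF l]] by simp
    qed
    then show "?p = 0 (basis_vec l)" by simp
  qed
  then show ?thesis by (simp add: ext_cocycles_def coordinate_in_grhom)
qed

lemma minimal_ext_coboundary_const_term:
  assumes F: "minimal_graded_free_resolution M F"
    and f: "f \<in> ext_coboundaries F ring_grmod i d" and v: "v \<in> carr (term_of F i)"
  shows "const_term (f v) = 0"
proof (cases i)
  case (Suc j)
  then obtain g where g: "g \<in> grhom (term_of F j) ring_grmod d" "f = g \<circ> diff F j"
    using f by (auto simp: ext_coboundaries_def)
  have v': "v \<in> carr (term_of F (Suc j))" using v Suc by simp
  have "f v = (\<Sum>l<length (gens F j). diff F j v l * g (basis_vec l))"
    using grhom_free_expansion[OF g(1) grhom_carr[OF diff_grhom[OF minimal_resolutionD[OF F]] v']]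
    by (simp add: g(2) ring_grmod_def)
  then show ?thesis
    by (simp add: lookup_sum const_term_mult minimal_diff_const_term[OF F v'])
qed (use f in \<open>simp add: ext_coboundaries_def\<close>)

lemma nonzero_Ext_ring_minimal:
  assumes M: "graded_module M" and F: "minimal_graded_free_resolution M F"
    and b: "b \<in> set (gens F i)" and le: "\<And>e. e \<in> set (gens F (Suc i)) \<Longrightarrow> e \<le> b"
  shows "nonzero_group (Ext M ring_grmod i (- b))"
proof -
  obtain j where j: "j < length (gens F i)" "gens F i ! j = b"
    using b by (auto simp: in_set_conv_nth)
  have "const_term (coordinate (gens F i) j (basis_vec j)) \<noteq> 0"
    by (simp add: coordinate_eq basis_vec_carr j(1)) (simp add: basis_vec_def)
  then have "coordinate (gens F i) j \<notin> ext_coboundaries F ring_grmod i (- b)"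
    using minimal_ext_coboundary_const_term[OF F _ basis_vec_carr[OF j(1)]] by blast
  moreover have "coordinate (gens F i) j \<in> ext_cocycles F ring_grmod i (- b)"
    using minimal_coordinate_cocycle[OF F j(1)] le j(2) by simp
  ultimately show ?thesis
    unfolding nonzero_Ext_iff[OF M graded_module_ring_grmod minimal_resolutionD[OF F]] by blast
qed

section \<open>The regularity as a maximum\<close>

lemma is_max_iff:
  "is_max T r \<longleftrightarrow>
    (\<forall>t\<in>T. ereal (of_int t) \<le> r) \<and> (r = -\<infinity> \<or> (\<exists>m\<in>T. r = ereal (of_int m)))"
  unfolding is_max_def by (cases "T = {}") auto

lemma is_max_UN:
  assumes T: "\<And>i. is_max (T i) (r i)" and fin: "finite (range r)"
  shows "is_max (\<Union>i. T i) (Max (range r))"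
  unfolding is_max_iff
proof (intro conjI ballI)
  fix t assume "t \<in> (\<Union>i. T i)"
  then obtain i where "ereal (of_int t) \<le> r i" using T by (auto simp: is_max_iff)
  also have "\<dots> \<le> Max (range r)" using fin by simp
  finally show "ereal (of_int t) \<le> Max (range r)" .
next
  obtain i where "Max (range r) = r i" using Max_in[OF fin] by auto
  then show "Max (range r) = -\<infinity> \<or> (\<exists>m\<in>\<Union>i. T i. Max (range r) = ereal (of_int m))"
    using T[of i] by (auto simp: is_max_iff)
qed

lemma is_max_shift:
  assumes "is_max T r"
  shows "is_max {t. t + c \<in> T} (r - ereal (of_int c))"
proof (cases "r = -\<infinity>")
  case True
  then show ?thesis using assms by (auto simp: is_max_iff)
next
  case False
  then obtain m where m: "m \<in> T" "r = ereal (of_int m)" "\<forall>t\<in>T. t \<le> m"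
    using assms by (auto simp: is_max_iff)
  then show ?thesis
    by (auto simp: is_max_iff le_diff_eq simp flip: of_int_add of_int_diff
        intro!: bexI[of _ "m - c"])
qed

lemma is_max_cofinal:
  assumes S: "is_max S r" and le: "\<And>t. t \<in> T \<Longrightarrow> \<exists>s\<in>S. t \<le> s"
    and attained: "\<And>m. m \<in> S \<Longrightarrow> (\<And>s. s \<in> S \<Longrightarrow> s \<le> m) \<Longrightarrow> m \<in> T"
  shows "is_max T r"
proof (cases "S = {}")
  case True
  then have "T = {}" using le by blast
  then show ?thesis using S True by (simp add: is_max_def)
next
  case False
  then obtain m where m: "m \<in> S" "\<And>s. s \<in> S \<Longrightarrow> s \<le> m" "r = ereal (of_int m)"
    using S by (auto simp: is_max_def)
  then have "m \<in> T" using attained by blast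
  moreover have "t \<le> m" if "t \<in> T" for t using le[OF that] m(2) by force
  ultimately show ?thesis using m(3) by (auto simp: is_max_def)
qed

definition betti_rows :: "('r, 'm) gfree_complex \<Rightarrow> int set" where
  "betti_rows P = {t. \<exists>i. t + int i \<in> set (gens P i)}"

lemma is_max_max_gen_degree: "is_max (set (gens P i)) (max_gen_degree P i)"
  by (auto simp: is_max_def max_gen_degree_def intro!: bexI[of _ "Max (set (gens P i))"])

lemma is_max_betti_rows:
  assumes bounded: "\<forall>i>s. gens P i = []"
  shows "is_max (betti_rows P) (reg P)"
proof -
  let ?r = "\<lambda>i. max_gen_degree P i - ereal (real i)"
  have "?r i = -\<infinity>" if "i > s" for i using bounded that by (simp add: max_gen_degree_def)
  then have "range ?r \<subseteq> insert (-\<infinity>) (?r ` {..s})" by (auto simp: not_le[symmetric])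
  then have "finite (range ?r)" by (rule finite_subset) simp
  moreover have "is_max {t. t + int i \<in> set (gens P i)} (?r i)" for i
    using is_max_shift[OF is_max_max_gen_degree[of P i], of "int i"] by simp
  ultimately have "is_max (\<Union>i. {t. t + int i \<in> set (gens P i)}) (Max (range ?r))"
    by (intro is_max_UN)
  moreover have "(\<Union>i. {t. t + int i \<in> set (gens P i)}) = betti_rows P"
    by (auto simp: betti_rows_def)
  ultimately show ?thesis by (simp add: reg_def full_SetCompr_eq)
qed

lemma last_generator_in_top_betti_row:
  assumes bounded: "\<forall>i>s. gens P i = []"
    and m: "m \<in> betti_rows P" and top: "\<And>t. t \<in> betti_rows P \<Longrightarrow> t \<le> m"
  shows "\<exists>i. m + int i \<in> set (gens P i) \<and> (\<forall>e\<in>set (gens P (Suc i)). e \<le> m + int i)"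
proof -
  define I where "I = {i. m + int i \<in> set (gens P i)}"
  have "I \<subseteq> {..s}" using bounded by (force simp: I_def not_le[symmetric])
  then have fin: "finite I" by (rule finite_subset) simp
  have "I \<noteq> {}" using m by (auto simp: I_def betti_rows_def)
  then have "Max I \<in> I" by (rule Max_in[OF fin])
  moreover have "e \<le> m + int (Max I)" if e: "e \<in> set (gens P (Suc (Max I)))" for e
  proof -
    have "e - int (Suc (Max I)) \<in> betti_rows P"
      using e by (auto simp: betti_rows_def intro!: exI[of _ "Suc (Max I)"])
    then have "e \<le> m + int (Suc (Max I))" using top by force
    moreover have "Suc (Max I) \<notin> I" using Max_ge[OF fin] by fastforce
    then have "e \<noteq> m + int (Suc (Max I))" using e by (auto simp: I_def)
    ultimately show ?thesis by simp
  qed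
  ultimately show ?thesis unfolding I_def by blast
qed

lemma is_max_Ext_ring_degrees:
  assumes M: "graded_module M" and F: "minimal_graded_free_resolution M F"
    and bounded: "\<forall>i>s. gens F i = []" and r: "is_max (betti_rows F) r"
  shows "is_max {t. \<exists>i. nonzero_group (Ext M ring_grmod i (- t - int i))} r" (is "is_max ?E r")
proof (rule is_max_cofinal[OF r])
  fix t assume "t \<in> ?E"
  then obtain i e where "e \<in> set (gens F i)" "- (- t - int i) \<le> e"
    using nonzero_Ext_ring_degree_bound[OF M minimal_resolutionD[OF F]] by blast
  then show "\<exists>u\<in>betti_rows F. t \<le> u"
    by (intro bexI[of _ "e - int i"]) (auto simp: betti_rows_def intro!: exI[of _ i])
next
  fix m assume "m \<in> betti_rows F" and "\<And>t. t \<in> betti_rows F \<Longrightarrow> t \<le> m"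
  then obtain i where "m + int i \<in> set (gens F i)"
    and "\<forall>e\<in>set (gens F (Suc i)). e \<le> m + int i"
    using last_generator_in_top_betti_row[OF bounded] by blast
  then have "nonzero_group (Ext M ring_grmod i (- (m + int i)))"
    by (intro nonzero_Ext_ring_minimal[OF M F]) simp_all
  then show "m \<in> ?E" by auto
qed

theorem proposition1p1:
  fixes M :: "(('x::finite, 'k::field) mpoly, 'm::ab_group_add) grmod"
    and F :: "(('x, 'k) mpoly, 'm) gfree_complex"
  assumes "graded_module M"
    and "finitely_generated M"
    and "minimal_graded_free_resolution M F"
  shows "is_max {t. \<exists>i. nonzero_group (Tor M residue_grmod i (t + int i))} (reg F) \<and>
         is_max {t. \<exists>i. nonzero_group (Ext M ring_grmod i (- t - int i))} (reg F)"
proof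
  note M = assms(1) and F = assms(3)
  obtain s where bounded: "\<forall>i>s. gens F i = []"
    using F by (auto simp: minimal_graded_free_resolution_def)
  have reg: "is_max (betti_rows F) (reg F)" by (rule is_max_betti_rows[OF bounded])
  then show "is_max {t. \<exists>i. nonzero_group (Tor M residue_grmod i (t + int i))} (reg F)"
    by (simp add: nonzero_Tor_residue_iff[OF M F] betti_rows_def)
  show "is_max {t. \<exists>i. nonzero_group (Ext M ring_grmod i (- t - int i))} (reg F)"
    by (rule is_max_Ext_ring_degrees[OF M F bounded reg])
qed

end
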